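(* (a) For any fixed integers $r\ge 3$, $1\le s\le r-1$ and $1\le t<r-s$, we have $\mathrm{ex}(n,K_{r+t},B_{r,s})=\Omega(n^{r-s-t-1})$ as $n\to\infty$. (b) For any fixed integers $r\ge 3$, $s\ge 1$, $t\ge 1$ with $2s+t+1<r$, and $n$ large enough, we have $\mathrm{ex}(n,K_{r+t},B_{r,s})=\Theta(n^{r-s-t-1})$. (c) For any fixed integers $t\ge 1$ and $r$ with $t+3<r$, and all $n$ large enough (depending on $r,t$), we have $$\mathrm{ex}(n,K_{r+t},B_{r,1})=\mathcal{N}(K_{r+t},\,K_{2t+2}\vee T(n-2t-2,\,r-t-2)).$$
   Context: All graphs are finite and simple. A graph is $F$-free if it does not contain $F$ as a (not necessarily induced) subgraph. $\mathcal{N}(H,G)$ denotes the number of unlabeled copies of $H$ in $G$, i.e. the number of (not necessarily induced) subgraphs of $G$ isomorphic to $H$. $\mathrm{ex}(n,H,F)$ is the maximum of $\mathcal{N}(H,G)$ over all $n$-vertex $F$-free graphs $G$. $K_m$ is the complete graph on $m$ vertices. $B_{r,s}$ is the graph consisting of two $r$-cliques sharing exactly $s$ vertices (so it has $2r-s$ vertices, and no edges other than those of the two cliques). $T(m,p)$ is the Turán graph: the complete $p$-partite graph on $m$ vertices with each part having order $\lfloor m/p\rfloor$ or $\lceil m/p\rceil$. $G_1\vee G_2$ is the join: the graph obtained from vertex-disjoint copies of $G_1,G_2$ by joining every vertex of $G_1$ to every vertex of $G_2$. The implied constants in $\Omega$ and $\Theta$ may depend on $r,s,t$ but not on $n$.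 *)

theory Defs
  imports Complex_Main "HOL-Library.Landau_Symbols"
begin

datatype 'a graph = Graph (verts: "'a set") (edges: "'a set set")

definition simple_graph :: "'a graph \<Rightarrow> bool" where
  "simple_graph G \<longleftrightarrow> finite (verts G) \<and> (\<forall>e\<in>edges G. e \<subseteq> verts G \<and> card e = 2)"

definition subgraph :: "'a graph \<Rightarrow> 'a graph \<Rightarrow> bool" where
  "subgraph S G \<longleftrightarrow> simple_graph S \<and> verts S \<subseteq> verts G \<and> edges S \<subseteq> edges G"

definition graph_iso :: "'a graph \<Rightarrow> 'b graph \<Rightarrow> bool" where
  "graph_iso G H \<longleftrightarrow> (\<exists>f. bij_betw f (verts G) (verts H) \<and>
     (\<forall>u\<in>verts G. \<forall>v\<in>verts G. {u, v} \<in> edges G \<longleftrightarrow> {f u, f v} \<in> edges H))"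

definition num_copies :: "'h graph \<Rightarrow> 'a graph \<Rightarrow> nat" where
  "num_copies H G = card {S. subgraph S G \<and> graph_iso S H}"

definition graph_free :: "'f graph \<Rightarrow> 'a graph \<Rightarrow> bool" where
  "graph_free F G \<longleftrightarrow> \<not> (\<exists>S. subgraph S G \<and> graph_iso S F)"

text \<open>Every finite graph has an isomorphic copy with natural numbers as vertices, so it is enough
  to let \<open>G\<close> range over those. The set of values is finite by \<open>finite_ex_num_values\<close> below.\<close>

definition ex_num :: "nat \<Rightarrow> 'h graph \<Rightarrow> 'f graph \<Rightarrow> nat" where
  "ex_num n H F =
     Max {num_copies H G | G :: nat graph.
            simple_graph G \<and> card (verts G) = n \<and> graph_free F G}"

definition clique_on :: "'a set \<Rightarrow> 'a graph" where
  "clique_on A = Graph A {e. e \<subseteq> A \<and> card e = 2}"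

definition complete_graph :: "nat \<Rightarrow> nat graph" where
  "complete_graph m = clique_on {..<m}"

text \<open>Meaningful for \<open>s \<le> r\<close>: the two \<open>r\<close>-sets then meet in the \<open>s\<close>-set \<open>{r - s..<r}\<close>.\<close>

definition book_graph :: "nat \<Rightarrow> nat \<Rightarrow> nat graph" where
  "book_graph r s =
     (let A = {..<r}; B = {r - s..<2 * r - s}
      in Graph (A \<union> B) (edges (clique_on A) \<union> edges (clique_on B)))"

text \<open>The \<open>p\<close> parts are the residue classes modulo \<open>p\<close>; see \<open>card_turan_part\<close> for their sizes.\<close>

definition turan_graph :: "nat \<Rightarrow> nat \<Rightarrow> nat graph" where
  "turan_graph m p = Graph {..<m} {{u, v} | u v. u < m \<and> v < m \<and> u mod p \<noteq> v mod p}"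

definition graph_join :: "'a graph \<Rightarrow> 'b graph \<Rightarrow> ('a + 'b) graph" where
  "graph_join G H = Graph (verts G <+> verts H)
     (image Inl ` edges G \<union> image Inr ` edges H \<union> {{Inl u, Inr v} | u v. u \<in> verts G \<and> v \<in> verts H})"

lemma finite_edges:
  assumes "simple_graph G"
  shows "finite (edges G)"
proof -
  have "edges G \<subseteq> Pow (verts G)" using assms by (auto simp: simple_graph_def)
  then show ?thesis using assms by (meson finite_Pow_iff finite_subset simple_graph_def)
qed

lemma num_copies_le:
  assumes "simple_graph G"
  shows "num_copies H G \<le> 2 ^ card (verts G) * 2 ^ (2 ^ card (verts G))"
proof -
  let ?P = "Pow (verts G) \<times> Pow (Pow (verts G))"
  have fin: "finite (verts G)" using assms by (simp add: simple_graph_def)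
  have "{S. subgraph S G \<and> graph_iso S H} \<subseteq> (\<lambda>(V, E). Graph V E) ` ?P"
  proof
    fix S assume "S \<in> {S. subgraph S G \<and> graph_iso S H}"
    then have "(verts S, edges S) \<in> ?P"
      by (auto simp: subgraph_def simple_graph_def)
    then show "S \<in> (\<lambda>(V, E). Graph V E) ` ?P"
      by (rule rev_image_eqI) simp
  qed
  moreover have "finite ?P" using fin by simp
  ultimately have "num_copies H G \<le> card ?P"
    unfolding num_copies_def by (meson card_image_le card_mono finite_imageI le_trans)
  also have "\<dots> = 2 ^ card (verts G) * 2 ^ (2 ^ card (verts G))"
    using fin by (simp add: card_cartesian_product card_Pow)
  finally show ?thesis .
qed

lemma finite_ex_num_values:
  "finite {num_copies H G | G :: nat graph.
             simple_graph G \<and> card (verts G) = n \<and> graph_free F G}"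
  by (rule finite_subset[of _ "{..2 ^ n * 2 ^ (2 ^ n)}"]) (auto intro: num_copies_le)

lemma card_turan_part:
  assumes "i < p"
  shows "card {v \<in> verts (turan_graph m p). v mod p = i} =
           (if i < m mod p then m div p + 1 else m div p)"
proof -
  have "{v \<in> verts (turan_graph m p). v mod p = i} = (\<lambda>q. q * p + i) ` {q. q * p + i < m}"
  proof (intro set_eqI iffI)
    fix v assume "v \<in> {v \<in> verts (turan_graph m p). v mod p = i}"
    then have "v < m" "v mod p = i" by (auto simp: turan_graph_def)
    then have "v = v div p * p + i" by (metis div_mult_mod_eq)
    with \<open>v < m\<close> show "v \<in> (\<lambda>q. q * p + i) ` {q. q * p + i < m}"
      by (intro image_eqI[of _ _ "v div p"]) auto
  qed (use assms in \<open>auto simp: turan_graph_def\<close>)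
  moreover have "inj (\<lambda>q. q * p + i)" using assms by (auto simp: inj_def)
  ultimately have "card {v \<in> verts (turan_graph m p). v mod p = i} = card {q. q * p + i < m}"
    by (simp add: card_image inj_on_subset)
  moreover have "{q. q * p + i < m} = {..<if i < m mod p then m div p + 1 else m div p}"
  proof (rule set_eqI)
    fix q
    define d where "d = m div p"
    define e where "e = m mod p"
    have m: "m = d * p + e" by (simp add: d_def e_def)
    have e: "e < p" using assms by (simp add: e_def)
    have "q * p + i < d * p + e \<longleftrightarrow> (if i < e then q < d + 1 else q < d)"
    proof (rule linorder_cases[of q d])
      assume qd: "q < d"
      then have "(q + 1) * p \<le> d * p" by (intro mult_le_mono1) simp
      then have "q * p + p \<le> d * p" by simp
      then have "q * p + i < d * p + e" using assms by linarith
      then show ?thesis using qd by simp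
    next
      assume qd: "d < q"
      then have "(d + 1) * p \<le> q * p" by (intro mult_le_mono1) simp
      then have "d * p + p \<le> q * p" by simp
      then have "\<not> q * p + i < d * p + e" using e by linarith
      then show ?thesis using qd by simp
    qed simp
    then show "q \<in> {q. q * p + i < m} \<longleftrightarrow>
        q \<in> {..<if i < m mod p then m div p + 1 else m div p}"
      unfolding d_def e_def by simp
  qed
  ultimately show ?thesis by simp
qed

end

theory Submission
  imports Defs "HOL-Library.FuncSet"
begin

text \<open>
  Write \<open>k = r + t\<close>, \<open>j = s + 2t + 1\<close> and \<open>p = r - s - t - 1\<close>, so that \<open>k = p + j\<close>. Discarding \<open>t\<close>
  vertices from each of two \<open>k\<close>-cliques shows that in a \<open>B\<^bsub>r,s\<^esub>\<close>-free graph two \<open>k\<close>-cliques never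
  meet in \<open>s, \<dots>, j - 1\<close> vertices. For the lower bounds take \<open>K\<^bsub>j\<^esub>\<close> joined to a complete \<open>p\<close>-partite
  graph: an \<open>r\<close>-clique contains at least \<open>s + t + 1\<close> of the \<open>j\<close> core vertices, so two of them share
  more than \<open>s\<close> vertices.

  The upper bound \<open>O(n\<^sup>p)\<close> is an argument of Frankl and Furedi. A positive proportion of the \<open>k\<close>-cliques
  is homogeneous: every intersection is the kernel of a large star, and the types of the intersections
  form an intersection-closed family on \<open>k\<close> points avoiding the sizes \<open>s, \<dots>, j - 1\<close>. By a theorem of
  Frankl and Katona some \<open>p\<close>-set is covered by no proper type, and the vertices in these \<open>p\<close>
  positions determine the clique.

  For the exact value with \<open>s = 1\<close>, cliques meet in no or at least \<open>j\<close> vertices. Call a \<open>j\<close>-set \<open>D\<close> good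
  if every \<open>k\<close>-clique meeting \<open>D\<close> contains it. Cliques without a good subset are \<open>o(n\<^sup>p)\<close> many. The
  cliques through a good \<open>D\<close> correspond to \<open>p\<close>-cliques of a \<open>K\<^bsub>p+1\<^esub>\<close>-free graph, whose number is bounded
  by Zykov's theorem, and they almost avoid the set \<open>W\<close> covered by the cliques disjoint from \<open>D\<close>.
  Convexity of \<open>x\<^sup>p\<close> then leaves no room for a nonempty \<open>W\<close> when the number of cliques is maximal.
\<close>

section \<open>The Frankl--Katona theorem\<close>

text \<open>Induction: since there are more rows than columns, double counting yields an incidence
  \<open>(i, x)\<close> with fewer columns through row \<open>i\<close> than rows through column \<open>x\<close>. A solution \<open>L\<close> for the
  remaining rows through \<open>x\<close> and the remaining columns through \<open>i\<close> extends to \<open>insert i L\<close>.\<close>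

lemma frankl_katona:
  fixes rel :: "'a \<Rightarrow> 'b \<Rightarrow> bool"
  assumes "finite Z" "finite R" "card R < card Z"
  shows "\<exists>I\<subseteq>Z. I \<noteq> {} \<and> card {x\<in>R. \<forall>i\<in>I. rel i x} = card I - 1"
  using assms
proof (induction "card R" arbitrary: Z R rule: less_induct)
  case less
  define a where "a i = {x\<in>R. rel i x}" for i
  define d where "d x = {i\<in>Z. rel i x}" for x
  note fin = \<open>finite Z\<close> \<open>finite R\<close>
  have fa: "finite (a i)" for i using fin by (simp add: a_def)
  have fd: "finite (d x)" for x using fin by (simp add: d_def)
  show ?case
  proof (cases "\<exists>i\<in>Z. a i = {}")
    case True
    then obtain i where "i \<in> Z" "a i = {}" by blast
    moreover have "card {x\<in>R. \<forall>l\<in>{i}. rel l x} = card (a i)" by (simp add: a_def)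
    ultimately have "{i} \<subseteq> Z \<and> {i} \<noteq> {} \<and> card {x\<in>R. \<forall>l\<in>{i}. rel l x} = card {i} - 1"
      by simp
    then show ?thesis by blast
  next
    case False
    \<comment> \<open>Weights \<open>1 / card (a i)\<close> on the incidences give each nonempty row
      total 1, hence \<open>card Z\<close> in all; weights \<open>1 / card (d x)\<close> give each
      column at most 1, an empty one 0. If no incidence had the shorter row, the first weight would
      never exceed the second and \<open>card Z \<le> card R\<close>.\<close>
    have "\<exists>i\<in>Z. \<exists>x\<in>a i. card (a i) < card (d x)"
    proof (rule ccontr)
      assume "\<not> ?thesis"
      then have le: "card (d x) \<le> card (a i)" if "i \<in> Z" "x \<in> a i" for i x
        using that by (metis not_less)
      have "real (card Z) = (\<Sum>i\<in>Z. \<Sum>x\<in>a i. 1 / card (a i))"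
        using False fa by (simp add: sum.cong[of Z Z _ "\<lambda>_. 1::real"])
      also have "\<dots> \<le> (\<Sum>i\<in>Z. \<Sum>x\<in>a i. 1 / card (d x))"
      proof (intro sum_mono)
        fix i x assume ix: "i \<in> Z" "x \<in> a i"
        then have "d x \<noteq> {}" by (auto simp: d_def a_def)
        then have "0 < card (d x)" using fd by (simp add: card_gt_0_iff)
        then show "1 / real (card (a i)) \<le> 1 / real (card (d x))"
          using le[OF ix] by (intro divide_left_mono) auto
      qed
      also have "\<dots> = (\<Sum>i\<in>Z. \<Sum>x\<in>R. if rel i x then 1 / card (d x) else 0)"
        unfolding a_def using fin by (simp add: sum.inter_filter)
      also have "\<dots> = (\<Sum>x\<in>R. \<Sum>i\<in>Z. if rel i x then 1 / card (d x) else 0)"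
        by (rule sum.swap)
      also have "\<dots> = (\<Sum>x\<in>R. \<Sum>i\<in>d x. 1 / card (d x))"
      proof (rule sum.cong[OF refl])
        fix x
        have "(\<Sum>i\<in>d x. c) = (\<Sum>i\<in>Z. if rel i x then c else 0)" for c :: real
          unfolding d_def using fin by (simp only: sum.inter_filter)
        then show "(\<Sum>i\<in>Z. if rel i x then 1 / real (card (d x)) else 0) =
            (\<Sum>i\<in>d x. 1 / real (card (d x)))" by (rule sym)
      qed
      also have "\<dots> \<le> (\<Sum>x\<in>R. 1)"
        by (intro sum_mono) simp
      also have "\<dots> = card R" by simp
      finally show False using less.prems by simp
    qed
    then obtain i x where i: "i \<in> Z" and x: "x \<in> a i" and lt: "card (a i) < card (d x)" by blast
    have xd: "x \<in> R" "rel i x" using x by (auto simp: a_def)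
    have id: "i \<in> d x" using i xd by (auto simp: d_def)
    have "card (a i - {x}) < card R"
      using x fin by (intro psubset_card_mono) (auto simp: a_def)
    moreover have "card (a i - {x}) < card (d x - {i})"
    proof -
      have "0 < card (a i)" using x fa by (auto simp: card_gt_0_iff)
      then show ?thesis using lt x id fa fd by simp
    qed
    ultimately obtain L where L: "L \<subseteq> d x - {i}" "L \<noteq> {}"
      and cL: "card {y\<in>a i - {x}. \<forall>l\<in>L. rel l y} = card L - 1"
      using less.hyps[of "a i - {x}" "d x - {i}"] fa fd by auto
    \<comment> \<open>Column \<open>x\<close> meets row \<open>i\<close> and, as
      \<open>L \<subseteq> d x\<close>, every row of \<open>L\<close>. So one new row comes with
      exactly one new common column.\<close>
    have eq: "{y\<in>R. \<forall>l\<in>insert i L. rel l y} = insert x {y\<in>a i - {x}. \<forall>l\<in>L. rel l y}"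
      using L xd by (auto simp: a_def d_def)
    have "finite L" using L fd finite_subset by blast
    then have cI: "card (insert i L) = Suc (card L)" using L by (subst card_insert_disjoint) auto
    have "card L > 0" using L \<open>finite L\<close> by (simp add: card_gt_0_iff)
    have "card {y\<in>R. \<forall>l\<in>insert i L. rel l y} = card (insert i L) - 1"
      unfolding eq cI using fa cL \<open>card L > 0\<close> by (subst card_insert_disjoint) auto
    moreover have "insert i L \<subseteq> Z" using L i by (auto simp: d_def)
    ultimately show ?thesis by blast
  qed
qed

text \<open>The full rows and full columns added here turn the gap of length \<open>g\<close> into the single
  value excluded by \<open>frankl_katona\<close>.\<close>

lemma exists_uncovered_subset:
  fixes M :: "'a set set"
  assumes fin: "finite U" and cU: "card U = p + s + g" and g: "1 \<le> g" and sp: "s \<le> p"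
    and sub: "\<And>A. A \<in> M \<Longrightarrow> A \<subset> U"
    and inter: "\<And>A B. A \<in> M \<Longrightarrow> B \<in> M \<Longrightarrow> A \<inter> B \<in> M"
    and gap: "\<And>A. A \<in> M \<Longrightarrow> card A < s \<or> s + g \<le> card A"
  shows "\<exists>P\<subseteq>U. card P = p \<and> (\<forall>A\<in>M. \<not> P \<subseteq> A)"
proof -
  \<comment> \<open>Supersets of uncovered sets inside \<open>U\<close> are uncovered, so it
    suffices that a smallest one has at most \<open>p\<close> points.\<close>
  define unc where "unc Z \<longleftrightarrow> Z \<subseteq> U \<and> (\<forall>A\<in>M. \<not> Z \<subseteq> A)" for Z
  have "unc U" unfolding unc_def using sub by blast
  then obtain Z where Z: "unc Z" and Zmin: "\<And>Y. unc Y \<Longrightarrow> card Z \<le> card Y"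
    using arg_min_nat_lemma[of unc U card] by blast
  have ZU: "Z \<subseteq> U" using Z by (simp add: unc_def)
  have fZ: "finite Z" using ZU fin finite_subset by blast
  have "card Z \<le> p"
  proof (rule ccontr)
    assume "\<not> card Z \<le> p"
    then obtain Z' where Z': "Z' \<subseteq> Z" "card Z' = p + 1"
      using obtain_subset_with_card_n[of "p+1" Z] by (metis Suc_eq_plus1 not_less_eq_eq)
    have fZ': "finite Z'" using Z' fZ finite_subset by blast
    \<comment> \<open>By minimality each \<open>z\<close> has a member of \<open>M\<close>
      containing the rest of \<open>Z\<close>; it misses \<open>z\<close> because \<open>Z\<close>
      itself is uncovered.\<close>
    have "\<exists>A\<in>M. Z - {z} \<subseteq> A" if "z \<in> Z" for z
    proof (rule ccontr)
      assume "\<not> ?thesis"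
      then have "unc (Z - {z})" using ZU by (auto simp: unc_def)
      then have "card Z \<le> card (Z - {z})" by (rule Zmin)
      then show False using that fZ by (metis card_Diff1_less not_less)
    qed
    then obtain m where m: "\<And>z. z \<in> Z \<Longrightarrow> m z \<in> M" "\<And>z. z \<in> Z \<Longrightarrow> Z - {z} \<subseteq> m z" by metis
    have mz: "z \<notin> m z" if "z \<in> Z" for z using m[OF that] Z by (auto simp: unc_def)
    define R where "R = U - Z'"
    have fR: "finite R" using fin by (simp add: R_def)
    have cR: "card R = s + g - 1" unfolding R_def using Z' ZU fin cU fZ' by (subst card_Diff_subset) auto
    \<comment> \<open>The rows are \<open>Z'\<close> padded by \<open>g - 1\<close> full rows, the
      columns are \<open>R\<close> padded by \<open>p - s\<close> full columns: \<open>p + g\<close>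
      rows against \<open>p + g - 1\<close> columns.\<close>
    define rel where "rel i x \<longleftrightarrow> (case i of Inl z \<Rightarrow> (case x of Inl y \<Rightarrow> y \<in> m z | Inr _ \<Rightarrow> True) | Inr _ \<Rightarrow> True)"
      for i :: "'a + nat" and x :: "'a + nat"
    have "card (R <+> {..<p - s}) < card (Z' <+> {..<g - 1})"
      using fR fZ' cR Z' g sp by (simp add: card_Plus)
    then obtain I where I: "I \<subseteq> Z' <+> {..<g - 1}" "I \<noteq> {}"
      and cI: "card {x\<in>R <+> {..<p - s}. \<forall>i\<in>I. rel i x} = card I - 1"
      using frankl_katona[of "Z' <+> {..<g - 1}" "R <+> {..<p - s}" rel] fR fZ' by auto
    define E where "E = {z. Inl z \<in> I}"
    define J where "J = {z. Inr z \<in> I}"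
    have EZ: "E \<subseteq> Z'" and JJ: "J \<subseteq> {..<g - 1}" using I by (auto simp: E_def J_def)
    have fE: "finite E" and fJ: "finite J" using EZ JJ fZ' finite_subset by auto
    have IEJ: "I = E <+> J" 
    proof (rule set_eqI)
      fix i show "i \<in> I \<longleftrightarrow> i \<in> E <+> J" by (cases i) (auto simp: E_def J_def)
    qed
    have cIE: "card I = card E + card J" using IEJ fE fJ by (simp add: card_Plus)
    have cJ: "card J \<le> g - 1" using JJ by (metis card_lessThan card_mono finite_lessThan)
    have "{x\<in>R <+> {..<p - s}. \<forall>i\<in>I. rel i x} = {y\<in>R. \<forall>z\<in>E. y \<in> m z} <+> {..<p - s}"
      by (auto simp: rel_def E_def split: sum.splits)
    then have ceq: "card {y\<in>R. \<forall>z\<in>E. y \<in> m z} + (p - s) = card E + card J - 1"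
      using cI cIE fR by (simp add: card_Plus)
    show False
    proof (cases "E = {}")
      case True
      then have "card J \<ge> 1"
        using I(2) IEJ fJ by (simp add: Suc_leI card_gt_0_iff)
      then show False using True ceq cR cJ g by simp
    next
      case False
      have fin_ne: "finite Y \<Longrightarrow> Y \<noteq> {} \<Longrightarrow> Y \<subseteq> Z \<Longrightarrow> (\<Inter>z\<in>Y. m z) \<in> M" for Y
        by (induction Y rule: finite_ne_induct) (auto intro: inter m)
      have EZ2: "E \<subseteq> Z" using EZ Z' by blast
      have inM: "(\<Inter>z\<in>E. m z) \<in> M" using fin_ne[OF fE False EZ2] .
      then have "(\<Inter>z\<in>E. m z) \<subseteq> U" using sub by blast
      \<comment> \<open>Each \<open>m z\<close> omits \<open>z\<close> and contains the rest of
        \<open>Z'\<close>, so inside \<open>Z'\<close> the intersection is exactly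
        \<open>Z' - E\<close>. By \<open>ceq\<close> its size is \<open>s + card J\<close>, which
        lies in the gap because \<open>card J \<le> g - 1\<close>.\<close>
      then have eq: "(\<Inter>z\<in>E. m z) = {y\<in>R. \<forall>z\<in>E. y \<in> m z} \<union> (Z' - E)"
      proof (intro set_eqI iffI)
        fix y assume y: "y \<in> (\<Inter>z\<in>E. m z)"
        then have "y \<notin> E" using mz EZ2 by blast
        then show "y \<in> {y\<in>R. \<forall>z\<in>E. y \<in> m z} \<union> (Z' - E)"
          using y \<open>(\<Inter>z\<in>E. m z) \<subseteq> U\<close> unfolding R_def by auto
      next
        fix y assume y: "y \<in> {y\<in>R. \<forall>z\<in>E. y \<in> m z} \<union> (Z' - E)"
        have "y \<in> m z" if "z \<in> E" "y \<in> Z' - E" for z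
          using m(2)[of z] that EZ2 Z' by blast
        then show "y \<in> (\<Inter>z\<in>E. m z)" using y by blast
      qed
      have "card (\<Inter>z\<in>E. m z) = card {y\<in>R. \<forall>z\<in>E. y \<in> m z} + card (Z' - E)"
        unfolding eq using fR fZ' by (intro card_Un_disjoint) (auto simp: R_def)
      moreover have "card (Z' - E) = p + 1 - card E"
        using EZ fE Z' by (simp add: card_Diff_subset)
      moreover have "card E \<le> p + 1" using EZ fZ' Z' by (metis card_mono)
      moreover have "card E \<ge> 1" using False fE by (simp add: Suc_leI card_gt_0_iff)
      ultimately have "s \<le> card (\<Inter>z\<in>E. m z)" "card (\<Inter>z\<in>E. m z) < s + g"
        using ceq cJ g sp by linarith+
      then show False using gap[OF inM] by linarith
    qed
  qed
  moreover have "p \<le> card U" using cU by simp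
  ultimately obtain P where "Z \<subseteq> P" "P \<subseteq> U" "card P = p"
    using exists_subset_between[of Z p U] ZU fin by blast
  moreover from this have "\<forall>A\<in>M. \<not> P \<subseteq> A"
    using Z unfolding unc_def by (meson order_trans)
  ultimately show ?thesis by blast
qed

section \<open>Homogeneous subfamilies\<close>

text \<open>Stands in for \<open>T\<close> being the kernel of a large sunflower:
  \<open>k + 1\<close> members with pairwise intersection \<open>T\<close> imply it, and avoiding
  \<open>k\<close> points is all that the argument uses.\<close>

definition robust :: "nat \<Rightarrow> 'a set set \<Rightarrow> 'a set \<Rightarrow> bool" where
  "robust k F T \<longleftrightarrow> (\<forall>Y. finite Y \<and> card Y \<le> k \<and> Y \<inter> T = {} \<longrightarrow> (\<exists>A\<in>F. T \<subseteq> A \<and> A \<inter> Y = {}))"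

text \<open>When \<chi> is injective on \<open>A\<close>, colours are positions and sets of colours
  are types; this is the part of \<open>A\<close> in the positions \<open>J\<close>.\<close>

definition proj :: "('a \<Rightarrow> 'c) \<Rightarrow> 'c set \<Rightarrow> 'a set \<Rightarrow> 'a set" where
  "proj \<chi> J A = {a\<in>A. \<chi> a \<in> J}"

lemma robust_mono: "robust k F T \<Longrightarrow> F \<subseteq> G \<Longrightarrow> robust k G T"
  unfolding robust_def by (intro allI impI) (drule spec, drule (1) mp, blast)

lemma robustD:
  assumes "robust k F T" "finite Y" "card Y \<le> k" "Y \<inter> T = {}"
  obtains A where "A \<in> F" "T \<subseteq> A" "A \<inter> Y = {}"
proof -
  have "\<exists>A\<in>F. T \<subseteq> A \<and> A \<inter> Y = {}" using assms unfolding robust_def by simp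
  then show ?thesis using that by blast
qed

lemma not_robustE:
  assumes "\<not> robust k F T"
  obtains Y where "finite Y" "card Y \<le> k" "Y \<inter> T = {}" "\<forall>A\<in>F. T \<subseteq> A \<longrightarrow> A \<inter> Y \<noteq> {}"
proof (rule ccontr)
  assume no: "\<not> thesis"
  have "robust k F T" unfolding robust_def
  proof (intro allI impI)
    fix Y assume Y: "finite Y \<and> card Y \<le> k \<and> Y \<inter> T = {}"
    show "\<exists>A\<in>F. T \<subseteq> A \<and> A \<inter> Y = {}"
    proof (rule ccontr)
      assume "\<not> ?thesis"
      then have "\<forall>A\<in>F. T \<subseteq> A \<longrightarrow> A \<inter> Y \<noteq> {}" by simp
      with no Y that[of Y] show False by simp
    qed
  qed
  with assms show False by simp
qed

text \<open>Choose \<open>A\<close> around \<open>T1\<close> avoiding \<open>T2 - T1\<close>, then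
  \<open>B\<close> around \<open>T2\<close> avoiding \<open>A - T2\<close>. Both avoided sets have
  at most \<open>k\<close> points because members do, and \<open>A0\<close> bounds
  \<open>T2\<close>.\<close>

lemma robust_inter:
  assumes T1: "robust k F T1" and T2: "robust k F T2" and fin: "\<And>A. A \<in> F \<Longrightarrow> finite A \<and> card A \<le> k"
    and sub: "T2 \<subseteq> A0" "A0 \<in> F"
  shows "\<exists>A\<in>F. \<exists>B\<in>F. A \<inter> B = T1 \<inter> T2"
proof -
  have f2: "finite T2" "card T2 \<le> k"
    using sub fin[of A0] finite_subset[of T2 A0] card_mono[of A0 T2] by auto
  have "card (T2 - T1) \<le> k" using f2 card_mono[of T2 "T2 - T1"] by auto
  then obtain A where A: "A \<in> F" "T1 \<subseteq> A" "A \<inter> (T2 - T1) = {}"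
    using robustD[OF T1, of "T2 - T1"] f2 by blast
  have "finite (A - T2)" "card (A - T2) \<le> k"
    using fin[OF A(1)] by (auto intro: order_trans[OF card_mono[of A "A - T2"]])
  then obtain B where B: "B \<in> F" "T2 \<subseteq> B" "B \<inter> (A - T2) = {}"
    using robustD[OF T2, of "A - T2"] by blast
  have "A \<inter> B = T1 \<inter> T2" using A B by blast
  then show ?thesis using A B by blast
qed

lemma not_robust_empty: "\<not> robust k {} T"
proof
  assume "robust k {} T"
  then obtain A :: "'a set" where "A \<in> {}" by (rule robustD[of _ _ _ "{}"]) auto
  then show False by simp
qed

text \<open>Delete the fibres of \<open>proj \<chi> J\<close> that violate robustness one after the other; \<open>\<kappa>\<close> records the
  type for which a set was deleted.\<close>

lemma peel_nonrobust:
  fixes \<chi> :: "'a \<Rightarrow> 'c"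
  assumes "finite F"
  shows "\<exists>G \<kappa>. G \<subseteq> F \<and> (\<forall>A\<in>G. \<forall>J\<in>JJ. robust k G (proj \<chi> J A)) \<and> (\<forall>A\<in>F - G. \<kappa> A \<in> JJ) \<and>
    (\<forall>J T. \<not> robust k {A\<in>F - G. \<kappa> A = J \<and> proj \<chi> J A = T} T)"
  using assms
proof (induction "card F" arbitrary: F rule: less_induct)
  case less
  show ?case
  proof (cases "\<forall>A\<in>F. \<forall>J\<in>JJ. robust k F (proj \<chi> J A)")
    case True
    then show ?thesis by (intro exI[of _ F] exI[of _ "\<lambda>_. undefined"]) (simp add: not_robust_empty)
  next
    case False
    then obtain A0 J0 where A0: "A0 \<in> F" "J0 \<in> JJ" and nr: "\<not> robust k F (proj \<chi> J0 A0)" by blast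
    define T0 where "T0 = proj \<chi> J0 A0"
    define F' where "F' = {A\<in>F. proj \<chi> J0 A \<noteq> T0}"
    have "A0 \<notin> F'" by (auto simp: F'_def T0_def)
    then have "F' \<subset> F" using A0 by (auto simp: F'_def)
    then have "card F' < card F" using less.prems by (rule psubset_card_mono[rotated])
    moreover have "finite F'" using less.prems by (simp add: F'_def)
    ultimately have "\<exists>G \<kappa>. G \<subseteq> F' \<and> (\<forall>A\<in>G. \<forall>J\<in>JJ. robust k G (proj \<chi> J A)) \<and> (\<forall>A\<in>F' - G. \<kappa> A \<in> JJ) \<and>
      (\<forall>J T. \<not> robust k {A\<in>F' - G. \<kappa> A = J \<and> proj \<chi> J A = T} T)"
      by (rule less.hyps)
    then obtain G \<kappa> where G: "G \<subseteq> F'" "\<forall>A\<in>G. \<forall>J\<in>JJ. robust k G (proj \<chi> J A)"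
      and \<kappa>: "\<forall>A\<in>F' - G. \<kappa> A \<in> JJ"
      and Y: "\<forall>J T. \<not> robust k {A\<in>F' - G. \<kappa> A = J \<and> proj \<chi> J A = T} T"
      by (elim exE conjE) (rule that)
    define \<kappa>' where "\<kappa>' A = (if proj \<chi> J0 A = T0 then J0 else \<kappa> A)" for A
    have k1: "\<forall>A\<in>F - G. \<kappa>' A \<in> JJ" using \<kappa> A0(2) by (simp add: \<kappa>'_def F'_def)
    \<comment> \<open>The fibre over \<open>(J0, T0)\<close> failed already inside \<open>F\<close>.
      Sets of any other fibre survive the first deletion and keep their label, so the induction
      hypothesis covers them.\<close>
    have k2: "\<not> robust k {A\<in>F - G. \<kappa>' A = J \<and> proj \<chi> J A = T} T" for J T
    proof (cases "J = J0 \<and> T = T0")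
      case True
      then show ?thesis using nr robust_mono[of k _ T0 F] by (auto simp: T0_def)
    next
      case False
      then have "{A\<in>F - G. \<kappa>' A = J \<and> proj \<chi> J A = T} \<subseteq> {A\<in>F' - G. \<kappa> A = J \<and> proj \<chi> J A = T}"
        by (auto simp: \<kappa>'_def F'_def)
      then show ?thesis using Y robust_mono by blast
    qed
    have "G \<subseteq> F" using G(1) by (auto simp: F'_def)
    then show ?thesis using G(2) k1 k2 by (intro exI[of _ G] exI[of _ \<kappa>']) simp
  qed
qed

lemma sum_card_fibres:
  assumes "finite D" "finite S" "h ` D \<subseteq> S"
  shows "(\<Sum>T\<in>S. card {A\<in>D. h A = T}) = card D"
proof -
  have "(\<Sum>T\<in>S. \<Sum>A\<in>{A\<in>D. h A = T}. 1) = (\<Sum>A\<in>D. 1::nat)" by (rule sum.group[OF assms])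
  then show ?thesis by simp
qed

text \<open>In every fibre keep only the sets through one popular point outside \<open>T\<close>, so that no two of
  them meet exactly in \<open>T\<close>.\<close>

lemma kill_type:
  fixes \<chi> :: "'a \<Rightarrow> 'c"
  assumes fin: "finite D" and inj: "\<And>A. A \<in> D \<Longrightarrow> inj_on \<chi> A"
    and nr: "\<And>T. \<not> robust k {A\<in>D. proj \<chi> J A = T} T"
  shows "\<exists>D'\<subseteq>D. card D \<le> k * card D' \<and> (\<forall>A\<in>D'. \<forall>B\<in>D'. \<chi> ` (A \<inter> B) \<noteq> J)"
proof -
  define DT where "DT T = {A\<in>D. proj \<chi> J A = T}" for T
  have "\<exists>y. y \<notin> T \<and> card (DT T) \<le> k * card {A\<in>DT T. y \<in> A}" if ne: "DT T \<noteq> {}" for T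
  proof -
    have fD: "finite (DT T)" using fin by (simp add: DT_def)
    \<comment> \<open>\<open>Y\<close> hits every set of the fibre, so one of its at most
      \<open>k\<close> points lies in at least a \<open>k\<close>-th part of them.\<close>
    obtain Y where Y: "finite Y" "card Y \<le> k" "Y \<inter> T = {}"
      and hit: "\<forall>A\<in>DT T. T \<subseteq> A \<longrightarrow> A \<inter> Y \<noteq> {}"
      using not_robustE[OF nr[of T]] unfolding DT_def[symmetric] by metis
    have sub: "T \<subseteq> A" if "A \<in> DT T" for A using that by (auto simp: DT_def proj_def)
    have "Y \<noteq> {}" using ne hit sub by blast
    have "\<exists>y\<in>Y. \<forall>z\<in>Y. card {A\<in>DT T. z \<in> A} \<le> card {A\<in>DT T. y \<in> A}"
    proof -
      let ?c = "\<lambda>y. card {A\<in>DT T. y \<in> A}"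
      have "Max (?c ` Y) \<in> ?c ` Y" using Y \<open>Y \<noteq> {}\<close> by (intro Max_in) auto
      then obtain y where "y \<in> Y" "?c y = Max (?c ` Y)" by auto
      then show ?thesis using Y by (intro bexI[of _ y]) auto
    qed
    then obtain y where y: "y \<in> Y" "\<And>z. z \<in> Y \<Longrightarrow> card {A\<in>DT T. z \<in> A} \<le> card {A\<in>DT T. y \<in> A}" by blast
    have "DT T \<subseteq> (\<Union>z\<in>Y. {A\<in>DT T. z \<in> A})" using hit sub by blast
    then have "card (DT T) \<le> card (\<Union>z\<in>Y. {A\<in>DT T. z \<in> A})"
      using Y fD by (intro card_mono) auto
    also have "\<dots> \<le> (\<Sum>z\<in>Y. card {A\<in>DT T. z \<in> A})" by (rule card_UN_le[OF Y(1)])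
    also have "\<dots> \<le> (\<Sum>z\<in>Y. card {A\<in>DT T. y \<in> A})" by (intro sum_mono y)
    also have "\<dots> \<le> k * card {A\<in>DT T. y \<in> A}" using Y by simp
    finally show ?thesis using y Y by blast
  qed
  then obtain y where y: "\<And>T. DT T \<noteq> {} \<Longrightarrow> y T \<notin> T"
    "\<And>T. DT T \<noteq> {} \<Longrightarrow> card (DT T) \<le> k * card {A\<in>DT T. y T \<in> A}" by metis
  define D' where "D' = {A\<in>D. y (proj \<chi> J A) \<in> A}"
  have sub: "D' \<subseteq> D" by (auto simp: D'_def)
  have "card D = (\<Sum>T\<in>proj \<chi> J ` D. card (DT T))"
    unfolding DT_def using fin by (intro sum_card_fibres[symmetric]) auto
  also have "\<dots> \<le> (\<Sum>T\<in>proj \<chi> J ` D. k * card {A\<in>DT T. y T \<in> A})"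
    by (intro sum_mono y) (auto simp: DT_def)
  also have "\<dots> = k * (\<Sum>T\<in>proj \<chi> J ` D. card {A\<in>D'. proj \<chi> J A = T})"
    unfolding sum_distrib_left
    by (intro sum.cong refl arg_cong2[of _ _ _ _ "(*)"] arg_cong[of _ _ card]) (auto simp: DT_def D'_def)
  also have "(\<Sum>T\<in>proj \<chi> J ` D. card {A\<in>D'. proj \<chi> J A = T}) = card D'"
    using fin sub finite_subset by (intro sum_card_fibres) auto
  finally have "card D \<le> k * card D'" .
  \<comment> \<open>If the type were \<open>J\<close>, injectivity would make
    \<open>A \<inter> B\<close> the \<open>J\<close>-projection of both sets. They would then lie in
    one fibre and share its popular point, which is outside \<open>A \<inter> B\<close>.\<close>
  moreover have "\<chi> ` (A \<inter> B) \<noteq> J" if AB: "A \<in> D'" "B \<in> D'" for A B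
  proof
    assume J: "\<chi> ` (A \<inter> B) = J"
    have "proj \<chi> J A = A \<inter> B" "proj \<chi> J B = A \<inter> B"
      using J inj[of A] inj[of B] AB sub unfolding proj_def inj_on_def by blast+
    then have "y (A \<inter> B) \<in> A \<inter> B" "DT (A \<inter> B) \<noteq> {}"
      using AB by (auto simp: D'_def DT_def)
    then show False using y(1) by blast
  qed
  ultimately show ?thesis using sub by blast
qed

text \<open>Peel off the non-robust fibres. If at least half of the family survives, it is
  homogeneous for all of \<open>JJ\<close>. Otherwise the most frequent deletion type is eliminated
  by \<open>kill_type\<close>, and induction applies with one type fewer. Each such round costs a
  factor \<open>2 * card JJ * k\<close>.\<close>

lemma homogeneous_subfamily:
  fixes \<chi> :: "'a \<Rightarrow> 'c"
  assumes "finite JJ" "finite F" "\<And>A. A \<in> F \<Longrightarrow> inj_on \<chi> A"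
    and "\<And>A B. A \<in> F \<Longrightarrow> B \<in> F \<Longrightarrow> \<chi> ` (A \<inter> B) \<in> JJ"
  shows "\<exists>F' JJ'. F' \<subseteq> F \<and> card F \<le> (2 * (card JJ + 1) * (k + 1)) ^ card JJ * card F' \<and>
    (\<forall>A\<in>F'. \<forall>J\<in>JJ'. robust k F' (proj \<chi> J A)) \<and> (\<forall>A\<in>F'. \<forall>B\<in>F'. \<chi> ` (A \<inter> B) \<in> JJ')"
  using assms
proof (induction "card JJ" arbitrary: JJ F rule: less_induct)
  case less
  let ?c = "2 * (card JJ + 1) * (k + 1)"
  show ?case
  proof (cases "F = {}")
    case True
    then show ?thesis by (intro exI[of _ "{}"]) simp
  next
    case False
    then have JJne: "JJ \<noteq> {}" using less.prems(4) by blast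
    then have cJ: "card JJ \<ge> 1" using less.prems(1) by (simp add: Suc_leI card_gt_0_iff)
    obtain G \<kappa> where G: "G \<subseteq> F" "\<forall>A\<in>G. \<forall>J\<in>JJ. robust k G (proj \<chi> J A)"
      and \<kappa>: "\<forall>A\<in>F - G. \<kappa> A \<in> JJ"
      and nr: "\<forall>J T. \<not> robust k {A\<in>F - G. \<kappa> A = J \<and> proj \<chi> J A = T} T"
      using peel_nonrobust[OF less.prems(2), of JJ k \<chi>] by (elim exE conjE) (rule that)
    have fFG: "finite (F - G)" using less.prems(2) by simp
    show ?thesis
    proof (cases "card F \<le> 2 * card G")
      case True
      have "2 * card G \<le> ?c ^ card JJ * card G"
      proof (intro mult_le_mono1)
        have "2 \<le> ?c ^ 1" by simp
        also have "\<dots> \<le> ?c ^ card JJ" by (intro power_increasing cJ) simp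
        finally show "2 \<le> ?c ^ card JJ" .
      qed
      with True have "card F \<le> ?c ^ card JJ * card G" by linarith
      then show ?thesis using G less.prems(4)
        by (intro exI[of _ G] exI[of _ JJ] conjI ballI) (simp_all add: subset_iff)
    next
      case False
      have "card F = card G + card (F - G)"
        using G(1) less.prems(2) by (metis card_Diff_subset finite_subset card_mono le_add_diff_inverse)
      with False have big: "card F \<le> 2 * card (F - G)" by linarith
      let ?D = "\<lambda>J. {A\<in>F - G. \<kappa> A = J}"
      have "card (F - G) = (\<Sum>J\<in>JJ. card (?D J))"
        using \<kappa> by (intro sum_card_fibres[OF fFG less.prems(1), symmetric]) auto
      moreover have "\<exists>J\<in>JJ. (\<Sum>J\<in>JJ. card (?D J)) \<le> card JJ * card (?D J)"
      proof (rule ccontr)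
        assume "\<not> ?thesis"
        then have lt: "card JJ * card (?D J) < (\<Sum>J\<in>JJ. card (?D J))" if "J \<in> JJ" for J
          using that by (meson not_le)
        have "(\<Sum>J\<in>JJ. card JJ * card (?D J)) < (\<Sum>J\<in>JJ. (\<Sum>J\<in>JJ. card (?D J)))"
          by (rule sum_strict_mono[OF less.prems(1) JJne lt])
        then show False by (simp add: sum_distrib_left)
      qed
      ultimately obtain J where J: "J \<in> JJ" "card (F - G) \<le> card JJ * card (?D J)" by metis
      have "\<not> robust k {A\<in>?D J. proj \<chi> J A = T} T" for T
      proof -
        have "{A\<in>?D J. proj \<chi> J A = T} = {A\<in>F - G. \<kappa> A = J \<and> proj \<chi> J A = T}" by auto
        then show ?thesis using nr by metis
      qed
      moreover have "finite (?D J)" using less.prems(2) by simp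
      moreover have "inj_on \<chi> A" if "A \<in> ?D J" for A using that less.prems(3) by simp
      ultimately have "\<exists>D'\<subseteq>?D J. card (?D J) \<le> k * card D' \<and> (\<forall>A\<in>D'. \<forall>B\<in>D'. \<chi> ` (A \<inter> B) \<noteq> J)"
        by (intro kill_type)
      then obtain D' where D': "D' \<subseteq> ?D J" "card (?D J) \<le> k * card D'"
        and kill: "\<forall>A\<in>D'. \<forall>B\<in>D'. \<chi> ` (A \<inter> B) \<noteq> J"
        by (elim exE conjE) (rule that)
      have DF: "D' \<subseteq> F" using D' by auto
      have cJ': "card (JJ - {J}) = card JJ - 1" using J less.prems(1) by simp
      have lt: "card (JJ - {J}) < card JJ" using cJ cJ' by simp
      have "\<exists>F' JJ'. F' \<subseteq> D' \<and> card D' \<le> (2 * (card (JJ - {J}) + 1) * (k + 1)) ^ card (JJ - {J}) * card F' \<and>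
        (\<forall>A\<in>F'. \<forall>J\<in>JJ'. robust k F' (proj \<chi> J A)) \<and> (\<forall>A\<in>F'. \<forall>B\<in>F'. \<chi> ` (A \<inter> B) \<in> JJ')"
        using kill DF less.prems finite_subset[OF DF]
        by (intro less.hyps[OF lt]) (auto simp: subset_iff)
      then obtain F' JJ' where F': "F' \<subseteq> D'"
        and le: "card D' \<le> (2 * (card (JJ - {J}) + 1) * (k + 1)) ^ card (JJ - {J}) * card F'"
        and r: "\<forall>A\<in>F'. \<forall>J\<in>JJ'. robust k F' (proj \<chi> J A)" "\<forall>A\<in>F'. \<forall>B\<in>F'. \<chi> ` (A \<inter> B) \<in> JJ'"
        by (elim exE conjE) (rule that)
      have "card F \<le> 2 * (card JJ * (k * card D'))"
        using big J(2) D'(2) by (meson mult_le_mono2 order_trans)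
      also have "\<dots> \<le> ?c * card D'" by (simp add: algebra_simps)
      also have "\<dots> \<le> ?c * (?c ^ (card JJ - 1) * card F')"
      proof (intro mult_le_mono2 order_trans[OF le] mult_le_mono1)
        show "(2 * (card (JJ - {J}) + 1) * (k + 1)) ^ card (JJ - {J}) \<le> ?c ^ (card JJ - 1)"
          unfolding cJ' by (intro power_mono mult_le_mono) simp_all
      qed
      also have "\<dots> = ?c ^ card JJ * card F'"
      proof -
        have "x * (x ^ (card JJ - 1) * y) = x ^ card JJ * y" for x y :: nat
          using cJ by (simp only: mult.assoc[symmetric] power_Suc[symmetric]) simp
        then show ?thesis .
      qed
      finally show ?thesis using F' DF r
        by (intro exI[of _ F'] exI[of _ JJ']) (simp add: subset_iff)
    qed
  qed
qed

text \<open>Averaging over all colourings of \<open>V\<close> with \<open>k\<close> colours: the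
  extensions of one fixed bijection already make a given \<open>k\<close>-set rainbow in a fraction
  \<open>1 / k ^ k\<close> of them. For \<open>k = 0\<close> there may be no colouring into the
  empty palette, hence the separate case.\<close>

lemma exists_rainbow_colouring:
  assumes V: "finite V" and F: "\<And>A. A \<in> F \<Longrightarrow> A \<subseteq> V \<and> card A = k"
  shows "\<exists>\<chi> :: 'a \<Rightarrow> nat. card F \<le> k ^ k * card {A\<in>F. bij_betw \<chi> A {..<k}}"
proof (cases "k = 0")
  case True
  have "F \<subseteq> {{}}" using F V True finite_subset by fastforce
  moreover have "{A\<in>F. bij_betw (\<lambda>_. 0::nat) A {..<k}} = F"
    using calculation True by (auto simp: bij_betw_def)
  ultimately show ?thesis using True by (intro exI[of _ "\<lambda>_. 0"]) simp
next
  case False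
  have fF: "finite F" using F V by (intro finite_subset[of F "Pow V"]) auto
  define C where "C = PiE V (\<lambda>_. {..<k})"
  have fC: "finite C" unfolding C_def using V by (intro finite_PiE) auto
  have cC: "card C = k ^ card V" unfolding C_def using V by (simp add: card_PiE)
  have lower: "k ^ card V \<le> k ^ k * card {\<chi>\<in>C. bij_betw \<chi> A {..<k}}" if A: "A \<in> F" for A
  proof -
    have AV: "A \<subseteq> V" "card A = k" "finite A" using F[OF A] V finite_subset by auto
    obtain g where g: "bij_betw g A {..<k}"
      using AV by (metis finite_same_card_bij card_lessThan finite_lessThan)
    define P where "P = PiE V (\<lambda>v. if v \<in> A then {g v} else {..<k})"
    have "P \<subseteq> {\<chi>\<in>C. bij_betw \<chi> A {..<k}}"
    proof
      fix \<chi> assume \<chi>: "\<chi> \<in> P"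
      have eq: "\<chi> v = g v" if "v \<in> A" for v
        using \<chi> AV that unfolding P_def by (auto simp: PiE_iff split: if_splits)
      have "\<chi> \<in> C" using \<chi> g unfolding P_def C_def PiE_iff
        by (auto split: if_splits simp: bij_betw_def)
      moreover have "bij_betw \<chi> A {..<k}" using g eq by (simp cong: bij_betw_cong)
      ultimately show "\<chi> \<in> {\<chi>\<in>C. bij_betw \<chi> A {..<k}}" by simp
    qed
    then have "card P \<le> card {\<chi>\<in>C. bij_betw \<chi> A {..<k}}" using fC by (intro card_mono) auto
    moreover have "card P = k ^ (card V - k)"
    proof -
      have "card P = (\<Prod>v\<in>V. if v \<in> A then 1 else k)"
        unfolding P_def using V by (simp add: card_PiE if_distrib cong: if_cong)
      also have "\<dots> = (\<Prod>v\<in>V - A. k)"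
        using V AV by (subst prod.subset_diff[OF AV(1) V]) simp
      finally show ?thesis using V AV by (simp add: card_Diff_subset)
    qed
    moreover have "k ^ card V = k ^ k * k ^ (card V - k)"
      using AV V by (metis card_mono le_add_diff_inverse power_add)
    ultimately show ?thesis by simp
  qed
  show ?thesis
  proof (rule ccontr)
    assume "\<not> ?thesis"
    then have lt: "k ^ k * card {A\<in>F. bij_betw \<chi> A {..<k}} < card F" for \<chi> :: "'a \<Rightarrow> nat"
      by (meson not_le)
    have "card C > 0" using cC False by simp
    then have "C \<noteq> {}" by auto
    have "card F * k ^ card V = (\<Sum>A\<in>F. k ^ card V)" by simp
    also have "\<dots> \<le> (\<Sum>A\<in>F. k ^ k * card {\<chi>\<in>C. bij_betw \<chi> A {..<k}})"
      by (intro sum_mono lower)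
    also have "\<dots> = k ^ k * (\<Sum>A\<in>F. \<Sum>\<chi>\<in>C. if bij_betw \<chi> A {..<k} then 1 else 0)"
      using fC by (simp add: sum_distrib_left sum.If_cases Int_def)
    also have "\<dots> = k ^ k * (\<Sum>\<chi>\<in>C. \<Sum>A\<in>F. if bij_betw \<chi> A {..<k} then 1 else 0)"
      by (subst sum.swap) simp
    also have "\<dots> = (\<Sum>\<chi>\<in>C. k ^ k * card {A\<in>F. bij_betw \<chi> A {..<k}})"
      using fF by (simp add: sum_distrib_left sum.If_cases Int_def)
    also have "\<dots> < (\<Sum>\<chi>\<in>C. card F)" using fC \<open>C \<noteq> {}\<close> lt by (intro sum_strict_mono) auto
    also have "\<dots> = card F * k ^ card V" using cC by simp
    finally show False by simp
  qed
qed

lemma card_subsets_of_card_le: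
  assumes "finite V"
  shows "card {P. P \<subseteq> V \<and> card P = p} \<le> card V ^ p"
proof (cases "p \<le> card V")
  case True
  then show ?thesis using assms by (simp add: n_subsets binomial_le_pow)
next
  case False
  then have "card V choose p = 0" by (intro binomial_eq_0) simp
  then show ?thesis by (simp only: n_subsets[OF assms])
qed

text \<open>The factor \<open>k ^ k\<close> pays for a rainbow subfamily and the remaining constant
  for homogeneity with respect to the \<open>2 ^ k\<close> types. What is left injects into the
  \<open>p\<close>-subsets of \<open>V\<close>.\<close>

lemma card_family_gap_le:
  assumes V: "finite V" and k: "k = p + s + g" and g: "1 \<le> g" and sp: "s \<le> p"
    and F: "\<And>A. A \<in> F \<Longrightarrow> A \<subseteq> V \<and> card A = k"
    and gap: "\<And>A B. A \<in> F \<Longrightarrow> B \<in> F \<Longrightarrow> A \<noteq> B \<Longrightarrow> card (A \<inter> B) < s \<or> s + g \<le> card (A \<inter> B)"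
  shows "card F \<le> k ^ k * (2 * (2 ^ k + 1) * (k + 1)) ^ 2 ^ k * card V ^ p"
proof -
  let ?c = "(2 * (2 ^ k + 1) * (k + 1)) ^ 2 ^ k"
  obtain \<chi> :: "'a \<Rightarrow> nat" where \<chi>: "card F \<le> k ^ k * card {A\<in>F. bij_betw \<chi> A {..<k}}"
    using exists_rainbow_colouring[OF V F] by blast
  define H where "H = {A\<in>F. bij_betw \<chi> A {..<k}}"
  have HF: "H \<subseteq> F" by (auto simp: H_def)
  have fF: "finite F" using F V by (intro finite_subset[of F "Pow V"]) auto
  have fH: "finite H" using HF fF finite_subset by blast
  have bij: "bij_betw \<chi> A {..<k}" if "A \<in> H" for A using that by (simp add: H_def)
  have cP: "card (Pow {..<k}) = 2 ^ k" by (simp add: card_Pow)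
  have "\<exists>F' JJ'. F' \<subseteq> H \<and> card H \<le> ?c * card F' \<and>
    (\<forall>A\<in>F'. \<forall>J\<in>JJ'. robust k F' (proj \<chi> J A)) \<and> (\<forall>A\<in>F'. \<forall>B\<in>F'. \<chi> ` (A \<inter> B) \<in> JJ')"
    using fH bij
    by (intro homogeneous_subfamily[of "Pow {..<k}" H \<chi> k, unfolded cP]) (auto simp: bij_betw_def)
  then obtain F' JJ where F': "F' \<subseteq> H" and cH: "card H \<le> ?c * card F'"
    and rob': "\<forall>A\<in>F'. \<forall>J\<in>JJ. robust k F' (proj \<chi> J A)"
    and types': "\<forall>A\<in>F'. \<forall>B\<in>F'. \<chi> ` (A \<inter> B) \<in> JJ"
    by (elim exE conjE) (rule that)
  have rob: "robust k F' (proj \<chi> J A)" if "A \<in> F'" "J \<in> JJ" for A J using rob' that by simp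
  have types: "\<chi> ` (A \<inter> B) \<in> JJ" if "A \<in> F'" "B \<in> F'" for A B using types' that by simp
  have AF: "A \<subseteq> V" "card A = k" "finite A" "bij_betw \<chi> A {..<k}" if "A \<in> F'" for A
  proof -
    have AH: "A \<in> H" "A \<in> F" using that F' HF by auto
    then show "A \<subseteq> V" "card A = k" "bij_betw \<chi> A {..<k}" using F bij by auto
    then show "finite A" using V finite_subset by blast
  qed
  have "card F' \<le> card V ^ p"
  proof (cases "F' = {}")
    case False
    then obtain A0 where A0: "A0 \<in> F'" by blast
    \<comment> \<open>By \<open>robust_inter\<close> the intersection of two types is itself
      realised by two members. This gives closure under intersection and makes the gap hypothesis
      available for types.\<close>
    have meet: "\<exists>A\<in>F'. \<exists>B\<in>F'. A \<inter> B = proj \<chi> (J \<inter> J') A0" if J: "J \<in> JJ" "J' \<in> JJ" for J J'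
    proof -
      have "\<exists>A\<in>F'. \<exists>B\<in>F'. A \<inter> B = proj \<chi> J A0 \<inter> proj \<chi> J' A0"
        using rob[OF A0] J A0 AF
        by (intro robust_inter[of k F' _ _ A0]) (auto simp: proj_def)
      also have "proj \<chi> J A0 \<inter> proj \<chi> J' A0 = proj \<chi> (J \<inter> J') A0" by (auto simp: proj_def)
      finally show ?thesis .
    qed
    have im: "\<chi> ` proj \<chi> J A = J \<inter> {..<k}" if "A \<in> F'" for A J
      using AF(4)[OF that] unfolding proj_def bij_betw_def by auto
    have cpr: "card (proj \<chi> J A0) = card (J \<inter> {..<k})" for J
    proof -
      have "inj_on \<chi> (proj \<chi> J A0)"
        using AF(4)[OF A0] unfolding bij_betw_def proj_def by (auto intro: inj_on_subset)
      then show ?thesis using card_image[of \<chi> "proj \<chi> J A0"] im[OF A0] by simp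
    qed
    \<comment> \<open>\<open>JJ\<close> is not known to consist of subsets of \<open>{..<k}\<close>,
      hence the cut. The full type, which every member has with itself, is removed to leave proper
      types only.\<close>
    define M where "M = (\<lambda>J. J \<inter> {..<k}) ` JJ - {{..<k}}"
    have int1: "J \<inter> J' \<inter> {..<k} \<in> JJ" if J: "J \<in> JJ" "J' \<in> JJ" for J J'
    proof -
      obtain A B where "A \<in> F'" "B \<in> F'" "A \<inter> B = proj \<chi> (J \<inter> J') A0"
        using meet[OF J] by blast
      then show ?thesis using types[of A B] im[OF A0, of "J \<inter> J'"] by simp
    qed
    have "\<exists>P\<subseteq>{..<k}. card P = p \<and> (\<forall>J\<in>M. \<not> P \<subseteq> J)"
    proof (rule exists_uncovered_subset[OF _ _ g sp])
      show "card {..<k} = p + s + g" using k by simp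
      show "J \<subset> {..<k}" if "J \<in> M" for J using that by (auto simp: M_def)
      show "J \<inter> J' \<in> M" if JM: "J \<in> M" "J' \<in> M" for J J'
      proof -
        obtain L L' where L: "L \<in> JJ" "L' \<in> JJ" "J = L \<inter> {..<k}" "J' = L' \<inter> {..<k}"
          using JM by (auto simp: M_def)
        have "J \<inter> J' = (L \<inter> L' \<inter> {..<k}) \<inter> {..<k}" using L by blast
        moreover have "J \<inter> J' \<noteq> {..<k}" using that L by (auto simp: M_def)
        ultimately show ?thesis using int1[OF L(1,2)] unfolding M_def by blast
      qed
      show "card J < s \<or> s + g \<le> card J" if JM: "J \<in> M" for J
      proof -
        obtain L where L: "L \<in> JJ" "J = L \<inter> {..<k}" using JM by (auto simp: M_def)
        \<comment> \<open>Taking the same type twice realises it as an intersection of two members;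
          these differ because the type is proper.\<close>
        obtain A B where AB: "A \<in> F'" "B \<in> F'" "A \<inter> B = proj \<chi> L A0"
          using meet[OF L(1) L(1)] by auto
        have c: "card (A \<inter> B) = card J" using AB(3) cpr L by simp
        have "J \<subset> {..<k}" using that L by (auto simp: M_def)
        then have "card J < k" using psubset_card_mono[of "{..<k}" J] by simp
        then have "A \<noteq> B" using c AF(2)[OF AB(1)] by auto
        then show ?thesis using gap[of A B] AB F' HF c by (metis subsetD)
      qed
    qed simp
    then obtain P where P: "P \<subseteq> {..<k}" "card P = p" "\<And>J. J \<in> M \<Longrightarrow> \<not> P \<subseteq> J" by blast
    \<comment> \<open>Members agreeing in the positions \<open>P\<close> intersect in a type
      containing \<open>P\<close>. No proper type does, so the type is full and the members
      coincide.\<close>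
    have "inj_on (proj \<chi> P) F'"
    proof
      fix A B assume AB: "A \<in> F'" "B \<in> F'" "proj \<chi> P A = proj \<chi> P B"
      have "P = \<chi> ` proj \<chi> P A" using im[OF AB(1), of P] P(1) by auto
      moreover have "proj \<chi> P A \<subseteq> A \<inter> B"
        using AB(3) unfolding proj_def set_eq_iff by auto
      ultimately have "P \<subseteq> \<chi> ` (A \<inter> B)" by (metis image_mono)
      then have PAB: "P \<subseteq> \<chi> ` (A \<inter> B)" .
      have sub: "\<chi> ` (A \<inter> B) \<subseteq> {..<k}" using AF(4)[OF AB(1)] unfolding bij_betw_def by auto
      then have "\<chi> ` (A \<inter> B) = \<chi> ` (A \<inter> B) \<inter> {..<k}" by (rule Int_absorb2[symmetric])
      then have "\<chi> ` (A \<inter> B) \<in> (\<lambda>J. J \<inter> {..<k}) ` JJ"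
        using types[OF AB(1,2)] by (rule image_eqI)
      then have "\<chi> ` (A \<inter> B) = {..<k}"
        using P(3)[of "\<chi> ` (A \<inter> B)"] PAB unfolding M_def by auto
      then have "k \<le> card (A \<inter> B)" using AF(3)[OF AB(1)] by (metis card_image_le card_lessThan finite_Int)
      then have "A \<inter> B = A" "A \<inter> B = B"
        using AF[OF AB(1)] AF[OF AB(2)] card_seteq[of A "A \<inter> B"] card_seteq[of B "A \<inter> B"] by auto
      then show "A = B" by blast
    qed
    then have "card F' = card (proj \<chi> P ` F')" by (simp add: card_image)
    also have "\<dots> \<le> card {Q. Q \<subseteq> V \<and> card Q = p}"
    proof (rule card_mono)
      show "finite {Q. Q \<subseteq> V \<and> card Q = p}" using V by simp
      have "card (proj \<chi> P A) = p" if A: "A \<in> F'" for A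
      proof -
        have "\<chi> ` proj \<chi> P A = P" using im[OF A, of P] P(1) by auto
        moreover have "inj_on \<chi> (proj \<chi> P A)"
          using AF(4)[OF A] unfolding bij_betw_def proj_def by (auto intro: inj_on_subset)
        ultimately show ?thesis using P(2) card_image[of \<chi> "proj \<chi> P A"] by simp
      qed
      then show "proj \<chi> P ` F' \<subseteq> {Q. Q \<subseteq> V \<and> card Q = p}" using AF(1) by (auto simp: proj_def)
    qed
    also have "\<dots> \<le> card V ^ p" by (rule card_subsets_of_card_le[OF V])
    finally show ?thesis .
  qed simp
  then have "card H \<le> ?c * card V ^ p" using cH by (meson mult_le_mono2 order_trans)
  then have "k ^ k * card H \<le> k ^ k * (?c * card V ^ p)" by (rule mult_le_mono2)
  then show ?thesis using \<chi> unfolding H_def[symmetric] by (simp only: mult.assoc)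
qed

section \<open>Cliques and forbidden books\<close>

text \<open>Adjacency is a bare relation, so that passing to fewer vertices only changes the set
  \<open>V\<close> and no induced subgraph has to be formed.\<close>

definition clq :: "('a \<Rightarrow> 'a \<Rightarrow> bool) \<Rightarrow> 'a set \<Rightarrow> bool" where
  "clq E A \<longleftrightarrow> (\<forall>u\<in>A. \<forall>v\<in>A. u \<noteq> v \<longrightarrow> E u v)"

definition cliques :: "('a \<Rightarrow> 'a \<Rightarrow> bool) \<Rightarrow> 'a set \<Rightarrow> nat \<Rightarrow> 'a set set" where
  "cliques E V q = {A. A \<subseteq> V \<and> card A = q \<and> clq E A}"

lemma clq_subset: "clq E A \<Longrightarrow> B \<subseteq> A \<Longrightarrow> clq E B"
  unfolding clq_def by blast

lemma finite_cliques: "finite V \<Longrightarrow> finite (cliques E V q)"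
  unfolding cliques_def by (rule finite_subset[of _ "Pow V"]) auto

section \<open>Copies in graphs expressed through cliques\<close>

abbreviation adj :: "'a graph \<Rightarrow> 'a \<Rightarrow> 'a \<Rightarrow> bool" where
  "adj G u v \<equiv> {u, v} \<in> edges G"

lemma edge_clique_on [simp]: "{u, v} \<in> edges (clique_on A) \<longleftrightarrow> u \<noteq> v \<and> u \<in> A \<and> v \<in> A"
  by (auto simp: clique_on_def card_insert_if)

lemma verts_clique_on [simp]: "verts (clique_on A) = A"
  by (simp add: clique_on_def)

lemma simple_clique_on: "finite A \<Longrightarrow> simple_graph (clique_on A)"
  by (auto simp: simple_graph_def clique_on_def)

lemma edges_clique_on_subset:
  assumes "clq (adj G) A"
  shows "edges (clique_on A) \<subseteq> edges G"
proof
  fix e assume e: "e \<in> edges (clique_on A)"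
  then obtain u v where uv: "e = {u, v}"
    by (auto simp: clique_on_def card_2_iff)
  then show "e \<in> edges G" using e assms by (simp add: clq_def)
qed

text \<open>A complete copy is determined by its vertex set, so counting copies amounts to counting
  cliques.\<close>

lemma copies_complete_graph:
  assumes G: "simple_graph G"
  shows "{S. subgraph S G \<and> graph_iso S (complete_graph k)} = clique_on ` cliques (adj G) (verts G) k"
proof (intro set_eqI iffI)
  fix S assume "S \<in> {S. subgraph S G \<and> graph_iso S (complete_graph k)}"
  then have S: "simple_graph S" "verts S \<subseteq> verts G" "edges S \<subseteq> edges G"
    and "graph_iso S (complete_graph k)" by (auto simp: subgraph_def)
  then obtain f where f: "bij_betw f (verts S) {..<k}"
    and e: "\<forall>u\<in>verts S. \<forall>v\<in>verts S. {u, v} \<in> edges S \<longleftrightarrow> {f u, f v} \<in> edges (complete_graph k)"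
    by (auto simp: graph_iso_def complete_graph_def)
  have adjS: "{u, v} \<in> edges S \<longleftrightarrow> u \<noteq> v" if "u \<in> verts S" "v \<in> verts S" for u v
    using e that f unfolding complete_graph_def by (auto simp: bij_betw_def inj_on_def)
  have "edges S = edges (clique_on (verts S))"
  proof (intro set_eqI iffI)
    fix x assume "x \<in> edges S"
    then show "x \<in> edges (clique_on (verts S))"
      using S(1) by (auto simp: simple_graph_def clique_on_def)
  next
    fix x assume "x \<in> edges (clique_on (verts S))"
    then obtain u v where "x = {u, v}" "u \<noteq> v" "u \<in> verts S" "v \<in> verts S"
      by (auto simp: clique_on_def card_2_iff)
    then show "x \<in> edges S" using adjS by simp
  qed
  then have "S = clique_on (verts S)" by (cases S) (simp add: clique_on_def)
  moreover have "verts S \<in> cliques (adj G) (verts G) k"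
    using S adjS bij_betw_same_card[OF f] by (auto simp: cliques_def clq_def)
  ultimately show "S \<in> clique_on ` cliques (adj G) (verts G) k" by (rule image_eqI)
next
  fix S assume "S \<in> clique_on ` cliques (adj G) (verts G) k"
  then obtain A where A: "S = clique_on A" "A \<subseteq> verts G" "card A = k" "clq (adj G) A"
    by (auto simp: cliques_def)
  have fA: "finite A" using A G finite_subset by (auto simp: simple_graph_def)
  have "subgraph S G"
    using A fA edges_clique_on_subset[OF A(4)] by (simp add: subgraph_def simple_clique_on)
  moreover obtain f where f: "bij_betw f A {..<k}"
    using A(3) fA by (metis finite_same_card_bij card_lessThan finite_lessThan)
  then have "\<forall>u\<in>A. \<forall>v\<in>A. u \<noteq> v \<longleftrightarrow> f u \<noteq> f v \<and> f u < k \<and> f v < k"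
    by (auto simp: bij_betw_def inj_on_def)
  then have "graph_iso S (complete_graph k)"
    unfolding graph_iso_def A(1) complete_graph_def using f by (intro exI[of _ f]) auto
  ultimately show "S \<in> {S. subgraph S G \<and> graph_iso S (complete_graph k)}" by simp
qed

lemma num_copies_complete_graph:
  assumes "simple_graph G"
  shows "num_copies (complete_graph k) G = card (cliques (adj G) (verts G) k)"
proof -
  have "inj_on clique_on X" for X :: "'a set set"
    by (intro inj_onI) (metis verts_clique_on)
  then show ?thesis
    unfolding num_copies_def copies_complete_graph[OF assms] by (simp add: card_image)
qed

text \<open>Copies need not be induced, so edges between \<open>A - B\<close> and
  \<open>B - A\<close> do not matter: two \<open>r\<close>-cliques sharing \<open>s\<close> vertices
  already carry a copy. The isomorphism is glued from bijections of \<open>A - B\<close>,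
  \<open>A \<inter> B\<close> and \<open>B - A\<close>.\<close>

lemma graph_free_book_graph:
  assumes G: "simple_graph G" and sr: "s \<le> r"
  shows "graph_free (book_graph r s) G \<longleftrightarrow>
    (\<forall>A\<in>cliques (adj G) (verts G) r. \<forall>B\<in>cliques (adj G) (verts G) r. card (A \<inter> B) \<noteq> s)"
    (is "?free \<longleftrightarrow> ?no")
proof
  let ?A = "{..<r}" and ?B = "{r - s..<2 * r - s}"
  have vb: "verts (book_graph r s) = ?A \<union> ?B" by (simp add: book_graph_def Let_def)
  have eb: "{u, v} \<in> edges (book_graph r s) \<longleftrightarrow> u \<noteq> v \<and> (u \<in> ?A \<and> v \<in> ?A \<or> u \<in> ?B \<and> v \<in> ?B)" for u v
    unfolding book_graph_def Let_def by auto
  {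
    assume no: ?no
    show ?free unfolding graph_free_def
    proof
      assume "\<exists>S. subgraph S G \<and> graph_iso S (book_graph r s)"
      then obtain S f where S: "verts S \<subseteq> verts G" "edges S \<subseteq> edges G"
        and f: "bij_betw f (verts S) (?A \<union> ?B)"
        and e: "\<And>u v. u \<in> verts S \<Longrightarrow> v \<in> verts S \<Longrightarrow>
          {u, v} \<in> edges S \<longleftrightarrow> {f u, f v} \<in> edges (book_graph r s)"
        unfolding subgraph_def graph_iso_def vb by blast
      define P where "P X = {v\<in>verts S. f v \<in> X}" for X
      have cP: "card (P X) = card X" if "X \<subseteq> ?A \<union> ?B" for X
      proof -
        have "f ` P X = X" using f that unfolding P_def bij_betw_def by auto
        moreover have "inj_on f (P X)" using f unfolding P_def bij_betw_def by (auto intro: inj_on_subset)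
        ultimately show ?thesis using card_image[of f "P X"] by simp
      qed
      have "P X \<in> cliques (adj G) (verts G) r" if X: "X = ?A \<or> X = ?B" for X
      proof -
        have "card (P X) = r" using cP[of X] X sr by auto
        moreover have "{u, v} \<in> edges G" if "u \<in> P X" "v \<in> P X" "u \<noteq> v" for u v
        proof -
          have uv: "u \<in> verts S" "v \<in> verts S" "f u \<in> X" "f v \<in> X" using that by (auto simp: P_def)
          then have "f u \<noteq> f v" using f that(3) by (auto simp: bij_betw_def inj_on_def)
          then have "{f u, f v} \<in> edges (book_graph r s)" unfolding eb using uv(3,4) X by metis
          then have "{u, v} \<in> edges S" using e[OF uv(1,2)] by (rule iffD2[rotated])
          then show ?thesis using S by blast
        qed
        ultimately show ?thesis using S(1) unfolding cliques_def clq_def P_def by blast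
      qed
      then have "card (P ?A \<inter> P ?B) \<noteq> s" using no by blast
      moreover have "P ?A \<inter> P ?B = P {r - s..<r}" using sr by (auto simp: P_def)
      moreover have "card (P {r - s..<r}) = s" 
      proof -
        have "{r - s..<r} \<subseteq> ?A \<union> ?B" by auto
        then show ?thesis using cP[of "{r - s..<r}"] sr by simp
      qed
      ultimately show False by simp
    qed
  next
    assume free: ?free
    show ?no
    proof (intro ballI notI)
      fix A B assume AB: "A \<in> cliques (adj G) (verts G) r" "B \<in> cliques (adj G) (verts G) r"
        and s: "card (A \<inter> B) = s"
      have fV: "finite (verts G)" using G by (simp add: simple_graph_def)
      have A: "A \<subseteq> verts G" "card A = r" "clq (adj G) A" "finite A"
        and B: "B \<subseteq> verts G" "card B = r" "clq (adj G) B" "finite B"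
        using AB fV finite_subset by (auto simp: cliques_def)
      have "card (A - B) = r - s" "card (B - A) = r - s"
        using A B s card_Diff_subset_Int[of A B] card_Diff_subset_Int[of B A] by (auto simp: Int_commute)
      then obtain g1 g2 g3 where g1: "bij_betw g1 (A - B) {..<r - s}"
        and g2: "bij_betw g2 (A \<inter> B) {r - s..<r}" and g3: "bij_betw g3 (B - A) {r..<2 * r - s}"
        using finite_same_card_bij[of "A - B" "{..<r - s}"] finite_same_card_bij[of "A \<inter> B" "{r - s..<r}"]
          finite_same_card_bij[of "B - A" "{r..<2 * r - s}"] A B s sr by auto
      define f where "f x = (if x \<in> A then if x \<in> B then g2 x else g1 x else g3 x)" for x
      have "bij_betw f (A - B) {..<r - s}" "bij_betw f (A \<inter> B) {r - s..<r}" "bij_betw f (B - A) {r..<2 * r - s}"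
        using g1 g2 g3 bij_betw_cong[of "A - B" f g1] bij_betw_cong[of "A \<inter> B" f g2]
          bij_betw_cong[of "B - A" f g3] by (simp_all add: f_def)
      then have f1: "f ` (A - B) = {..<r - s}" "f ` (A \<inter> B) = {r - s..<r}" "f ` (B - A) = {r..<2 * r - s}"
        and fbij: "bij_betw f ((A - B) \<union> (A \<inter> B) \<union> (B - A)) ({..<r - s} \<union> {r - s..<r} \<union> {r..<2 * r - s})"
        using sr by (auto simp: bij_betw_imp_surj_on intro!: bij_betw_combine)
      have un: "(A - B) \<union> (A \<inter> B) \<union> (B - A) = A \<union> B" by blast
      have un2: "{..<r - s} \<union> {r - s..<r} \<union> {r..<2 * r - s} = ?A \<union> ?B" using sr by auto
      have bij: "bij_betw f (A \<union> B) (?A \<union> ?B)" using fbij unfolding un un2 .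
      have fA: "f x \<in> ?A \<longleftrightarrow> x \<in> A" and fB: "f x \<in> ?B \<longleftrightarrow> x \<in> B" if x: "x \<in> A \<union> B" for x
      proof -
        consider "x \<in> A - B" | "x \<in> A \<inter> B" | "x \<in> B - A" using x by blast
        then have "(f x \<in> ?A \<longleftrightarrow> x \<in> A) \<and> (f x \<in> ?B \<longleftrightarrow> x \<in> B)"
        proof cases
          case 1
          then have "f x \<in> {..<r - s}" using f1 by blast
          then show ?thesis using 1 sr by auto
        next
          case 2
          then have "f x \<in> {r - s..<r}" using f1 by blast
          then show ?thesis using 2 sr by auto
        next
          case 3
          then have "f x \<in> {r..<2 * r - s}" using f1 by blast
          then show ?thesis using 3 sr by auto
        qed
        then show "f x \<in> ?A \<longleftrightarrow> x \<in> A" "f x \<in> ?B \<longleftrightarrow> x \<in> B" by auto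
      qed
      define S where "S = Graph (A \<union> B) (edges (clique_on A) \<union> edges (clique_on B))"
      have "subgraph S G"
        using A B simple_clique_on[OF A(4)] simple_clique_on[OF B(4)]
          edges_clique_on_subset[OF A(3)] edges_clique_on_subset[OF B(3)]
        unfolding S_def subgraph_def simple_graph_def by auto
      moreover have "graph_iso S (book_graph r s)"
      proof -
        have "{u, v} \<in> edges S \<longleftrightarrow> {f u, f v} \<in> edges (book_graph r s)"
          if "u \<in> A \<union> B" "v \<in> A \<union> B" for u v
        proof -
          have "f u = f v \<longleftrightarrow> u = v" using bij that unfolding bij_betw_def inj_on_def by blast
          then show ?thesis unfolding eb fA[OF that(1)] fA[OF that(2)] fB[OF that(1)] fB[OF that(2)]
            by (auto simp: S_def)
        qed
        then show ?thesis using bij unfolding graph_iso_def vb S_def by (intro exI[of _ f]) auto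
      qed
      ultimately show False using free unfolding graph_free_def by blast
    qed
  }
qed

text \<open>Suppose between \<open>s\<close> and \<open>s + 2 * t\<close> vertices are common. Keep
  \<open>s\<close> of them as \<open>S\<close> and split the others into two batches of at most
  \<open>t\<close>, one removed from \<open>A\<close> and one from \<open>B\<close>. Padding each
  removal to \<open>t\<close> vertices outside \<open>S\<close> leaves \<open>r\<close>-cliques
  meeting exactly in \<open>S\<close>.\<close>

lemma clique_intersection_gap:
  assumes V: "finite V" and sr: "s \<le> r"
    and no: "\<And>X Y. X \<in> cliques E V r \<Longrightarrow> Y \<in> cliques E V r \<Longrightarrow> card (X \<inter> Y) \<noteq> s"
    and A: "A \<in> cliques E V (r + t)" and B: "B \<in> cliques E V (r + t)"
  shows "card (A \<inter> B) < s \<or> s + 2 * t + 1 \<le> card (A \<inter> B)"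
proof (rule ccontr)
  assume "\<not> ?thesis"
  then have c: "s \<le> card (A \<inter> B)" "card (A \<inter> B) \<le> s + 2 * t" by auto
  have A': "A \<subseteq> V" "card A = r + t" "clq E A" and B': "B \<subseteq> V" "card B = r + t" "clq E B"
    using A B by (auto simp: cliques_def)
  have fA: "finite A" and fB: "finite B" using A' B' V finite_subset by auto
  obtain S where S: "S \<subseteq> A \<inter> B" "card S = s" using c(1) by (metis obtain_subset_with_card_n)
  define C where "C = A \<inter> B - S"
  have fS: "finite S" using S fA finite_subset by blast
  have cC: "card C \<le> 2 * t" unfolding C_def using S fS c by (simp add: card_Diff_subset)
  have fC: "finite C" using fA by (simp add: C_def)
  obtain C1 where C1: "C1 \<subseteq> C" "card C1 = min t (card C)"
    by (metis obtain_subset_with_card_n min.cobounded2)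
  define C2 where "C2 = C - C1"
  have cC2: "card C2 \<le> t"
    unfolding C2_def using C1 fC cC finite_subset[OF C1(1)] by (simp add: card_Diff_subset)
  have pick: "\<exists>R. D \<subseteq> R \<and> R \<subseteq> Q - S \<and> card R = t"
    if "D \<subseteq> C" "card D \<le> t" "A \<inter> B \<subseteq> Q" "finite Q" "card Q = r + t" for D Q
  proof (rule exists_subset_between)
    show "D \<subseteq> Q - S" using that by (auto simp: C_def)
    have "card (Q - S) = r + t - s" using that S fS by (subst card_Diff_subset) auto
    then show "t \<le> card (Q - S)" using sr by simp
  qed (use that in auto)
  obtain R1 where R1: "C1 \<subseteq> R1" "R1 \<subseteq> A - S" "card R1 = t"
    using pick[of C1 A] C1 fA A' by auto
  obtain R2 where R2: "C2 \<subseteq> R2" "R2 \<subseteq> B - S" "card R2 = t"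
    using pick[of C2 B] cC2 fB B' by (auto simp: C2_def)
  have del: "Q - R \<in> cliques E V r" if Q: "Q \<subseteq> V" "card Q = r + t" "clq E Q" and R: "R \<subseteq> Q - S" "card R = t" for Q R
  proof -
    have "R \<subseteq> Q" "finite Q" using Q R V finite_subset by auto
    then have "card (Q - R) = r" using Q R finite_subset[of R Q] by (simp add: card_Diff_subset)
    then show ?thesis using Q clq_subset[OF Q(3), of "Q - R"] by (auto simp: cliques_def)
  qed
  have "A - R1 \<in> cliques E V r" "B - R2 \<in> cliques E V r"
    using del[OF A' R1(2,3)] del[OF B' R2(2,3)] by simp_all
  moreover have "(A - R1) \<inter> (B - R2) = S"
    using R1 R2 S unfolding C_def C2_def by blast
  ultimately show False using no S(2) by metis
qed

section \<open>The extremal graphs\<close>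

text \<open>The core \<open>D\<close> is joined to everything in \<open>W\<close>, which is complete multipartite with parts
  given by \<open>col\<close>; vertices outside \<open>D \<union> W\<close> are isolated.\<close>

definition core_partite ::
  "('a \<Rightarrow> 'a \<Rightarrow> bool) \<Rightarrow> 'a set \<Rightarrow> 'a set \<Rightarrow> 'a set \<Rightarrow> ('a \<Rightarrow> nat) \<Rightarrow> nat \<Rightarrow> bool" where
  "core_partite E V D W col p \<longleftrightarrow> finite V \<and> D \<union> W \<subseteq> V \<and> D \<inter> W = {} \<and> (\<forall>w\<in>W. col w < p) \<and>
     (\<forall>u\<in>V. \<forall>v\<in>V. u \<noteq> v \<longrightarrow>
        (E u v \<longleftrightarrow> u \<in> D \<union> W \<and> v \<in> D \<union> W \<and> (u \<in> D \<or> v \<in> D \<or> col u \<noteq> col v)))"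

text \<open>\<open>2 \<le> q\<close> keeps out singletons, which could be isolated vertices outside
  \<open>D \<union> W\<close>.\<close>

lemma core_partite_clique:
  assumes cp: "core_partite E V D W col p" and X: "X \<in> cliques E V q" and q: "2 \<le> q"
  shows "X \<subseteq> D \<union> W" "inj_on col (X \<inter> W)" "card (X \<inter> W) \<le> p" "card X = card (X \<inter> D) + card (X \<inter> W)"
    "finite X"
proof -
  have V: "finite V" and DW: "D \<inter> W = {}" and col: "\<And>w. w \<in> W \<Longrightarrow> col w < p"
    and E: "\<And>u v. u \<in> V \<Longrightarrow> v \<in> V \<Longrightarrow> u \<noteq> v \<Longrightarrow>
      E u v \<longleftrightarrow> u \<in> D \<union> W \<and> v \<in> D \<union> W \<and> (u \<in> D \<or> v \<in> D \<or> col u \<noteq> col v)"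
    using cp unfolding core_partite_def by auto
  have X': "X \<subseteq> V" "card X = q" and adj: "\<And>u v. u \<in> X \<Longrightarrow> v \<in> X \<Longrightarrow> u \<noteq> v \<Longrightarrow> E u v"
    using X by (auto simp: cliques_def clq_def)
  show fX: "finite X" using X' V finite_subset by blast
  show sub: "X \<subseteq> D \<union> W"
  proof
    fix x assume x: "x \<in> X"
    have "\<exists>y\<in>X. y \<noteq> x"
    proof (rule ccontr)
      assume "\<not> ?thesis"
      then have "X \<subseteq> {x}" by auto
      then have "card X \<le> 1" using card_mono[of "{x}" X] by simp
      then show False using X' q by simp
    qed
    then obtain y where "y \<in> X" "y \<noteq> x" by blast
    then show "x \<in> D \<union> W" using adj[of x y] E[of x y] x X' by auto
  qed
  show inj: "inj_on col (X \<inter> W)"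
  proof (rule inj_onI, rule ccontr)
    fix u v assume uv: "u \<in> X \<inter> W" "v \<in> X \<inter> W" "col u = col v" "u \<noteq> v"
    then have "E u v" using adj by simp
    then have "u \<in> D \<or> v \<in> D" using E[of u v] uv X' by auto
    then show False using uv DW by auto
  qed
  have "card (X \<inter> W) = card (col ` (X \<inter> W))" using inj by (simp add: card_image)
  also have "\<dots> \<le> card {..<p}" using col by (intro card_mono) auto
  finally show "card (X \<inter> W) \<le> p" by simp
  have "X = (X \<inter> D) \<union> (X \<inter> W)" using sub by blast
  then have "card X = card ((X \<inter> D) \<union> (X \<inter> W))" by simp
  also have "\<dots> = card (X \<inter> D) + card (X \<inter> W)" using fX DW by (intro card_Un_disjoint) auto
  finally show "card X = card (X \<inter> D) + card (X \<inter> W)" .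
qed

lemma core_partite_no_intersection:
  assumes cp: "core_partite E V D W col p" and D: "card D = s + 2 * t + 1" and r: "r = p + s + t + 1" "2 \<le> r"
    and X: "X \<in> cliques E V r" and Y: "Y \<in> cliques E V r"
  shows "card (X \<inter> Y) \<noteq> s"
proof -
  have fD: "finite D" using cp finite_subset unfolding core_partite_def by blast
  note cX = core_partite_clique[OF cp X r(2)] and cY = core_partite_clique[OF cp Y r(2)]
  have "card X = r" "card Y = r" using X Y by (auto simp: cliques_def)
  then have big: "s + t + 1 \<le> card (X \<inter> D)" "s + t + 1 \<le> card (Y \<inter> D)" using cX cY r by linarith+
  have "card (X \<inter> D) + card (Y \<inter> D) = card (X \<inter> D \<union> Y \<inter> D) + card ((X \<inter> D) \<inter> (Y \<inter> D))"
    using cX cY by (intro card_Un_Int) auto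
  moreover have "card (X \<inter> D \<union> Y \<inter> D) \<le> card D" using fD by (intro card_mono) auto
  moreover have "card ((X \<inter> D) \<inter> (Y \<inter> D)) \<le> card (X \<inter> Y)" using cX by (intro card_mono) auto
  ultimately show ?thesis using big D by linarith
qed

text \<open>At most \<open>p\<close> vertices come from \<open>W\<close>, so a clique of this size
  contains all of \<open>D\<close> and one vertex of each part: cliques correspond to transversals
  of the parts.\<close>

lemma card_cliques_core_partite:
  assumes cp: "core_partite E V D W col p" and q: "2 \<le> card D + p"
  shows "card (cliques E V (card D + p)) = (\<Prod>i<p. card {w\<in>W. col w = i})"
proof -
  have V: "finite V" and DWV: "D \<subseteq> V" "W \<subseteq> V" and DW: "D \<inter> W = {}" and col: "\<And>w. w \<in> W \<Longrightarrow> col w < p"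
    and E: "\<And>u v. u \<in> V \<Longrightarrow> v \<in> V \<Longrightarrow> u \<noteq> v \<Longrightarrow>
      E u v \<longleftrightarrow> u \<in> D \<union> W \<and> v \<in> D \<union> W \<and> (u \<in> D \<or> v \<in> D \<or> col u \<noteq> col v)"
    using cp unfolding core_partite_def by auto
  have fD: "finite D" using DWV V finite_subset by blast
  define P where "P = PiE {..<p} (\<lambda>i. {w\<in>W. col w = i})"
  define h where "h g = D \<union> g ` {..<p}" for g :: "nat \<Rightarrow> 'a"
  have g: "g i \<in> W" "col (g i) = i" if "g \<in> P" "i < p" for g i
    using that unfolding P_def PiE_iff by auto
  have "inj_on h P"
  proof
    fix g g' assume gg: "g \<in> P" "g' \<in> P" "h g = h g'"
    show "g = g'"
    proof
      fix i show "g i = g' i"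
      proof (cases "i < p")
        case True
        have "g i \<in> h g'" using gg(3) True unfolding h_def by blast
        then obtain l where l: "l < p" "g i = g' l" using g(1)[OF gg(1) True] DW by (auto simp: h_def)
        then have "l = i" using g(2)[OF gg(1) True] g(2)[OF gg(2) l(1)] by simp
        then show ?thesis using l by simp
      next
        case False
        then show ?thesis using gg(1,2) by (simp add: P_def PiE_iff extensional_def)
      qed
    qed
  qed
  moreover have "h ` P = cliques E V (card D + p)"
  proof (intro set_eqI iffI)
    fix X assume "X \<in> h ` P"
    then obtain f where f: "f \<in> P" "X = h f" by blast
    have "inj_on f {..<p}" using g(2)[OF f(1)] by (metis inj_onI lessThan_iff)
    then have "card (f ` {..<p}) = p" by (simp add: card_image)
    moreover have "D \<inter> f ` {..<p} = {}" using g(1)[OF f(1)] DW by auto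
    ultimately have "card X = card D + p" unfolding f(2) h_def using fD by (subst card_Un_disjoint) auto
    moreover have "E u v" if uv: "u \<in> X" "v \<in> X" "u \<noteq> v" for u v
    proof -
      have X: "x \<in> D \<or> (\<exists>i<p. x = f i)" if "x \<in> X" for x using that by (auto simp: f(2) h_def)
      have DWu: "u \<in> D \<union> W" "v \<in> D \<union> W" using X uv g(1)[OF f(1)] by blast+
      have "u \<in> D \<or> v \<in> D \<or> col u \<noteq> col v"
      proof (rule ccontr)
        assume no: "\<not> ?thesis"
        then obtain i l where "i < p" "u = f i" "l < p" "v = f l" using X uv by blast
        then show False using no uv(3) g(2)[OF f(1)] by auto
      qed
      then show ?thesis using DWu E[of u v] uv(3) DWV by blast
    qed
    moreover have "X \<subseteq> V" using DWV g(1)[OF f(1)] by (auto simp: f(2) h_def)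
    ultimately show "X \<in> cliques E V (card D + p)" by (auto simp: cliques_def clq_def)
  next
    fix X assume X: "X \<in> cliques E V (card D + p)"
    note c = core_partite_clique[OF cp X q]
    have cX: "card X = card D + p" using X by (simp add: cliques_def)
    have le: "card (X \<inter> D) \<le> card D" using fD by (intro card_mono) auto
    have cW: "card (X \<inter> W) = p" and cD: "card (X \<inter> D) = card D" using c(3,4) cX le by linarith+
    have DX: "X \<inter> D = D" using cD fD by (intro card_subset_eq) auto
    have "col ` (X \<inter> W) = {..<p}"
    proof (rule card_subset_eq)
      show "col ` (X \<inter> W) \<subseteq> {..<p}" using col by auto
      show "card (col ` (X \<inter> W)) = card {..<p}" using c(2) cW by (simp add: card_image)
    qed simp
    then have bij: "bij_betw col (X \<inter> W) {..<p}" using c(2) by (simp add: bij_betw_def)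
    define f where "f = restrict (inv_into (X \<inter> W) col) {..<p}"
    have bij2: "bij_betw (inv_into (X \<inter> W) col) {..<p} (X \<inter> W)" by (rule bij_betw_inv_into[OF bij])
    then have im: "f ` {..<p} = X \<inter> W" by (simp add: f_def bij_betw_def)
    have "f \<in> P"
    proof -
      have "f i \<in> W \<and> col (f i) = i" if "i < p" for i
        using that im bij_betw_inv_into_right[OF bij, of i] by (auto simp: f_def)
      then show ?thesis unfolding P_def by (auto simp: f_def PiE_iff)
    qed
    moreover have "X = h f" unfolding h_def im using DX c(1) by blast
    ultimately show "X \<in> h ` P" by blast
  qed
  ultimately have "card (cliques E V (card D + p)) = card P" by (metis card_image)
  also have "\<dots> = (\<Prod>i<p. card {w\<in>W. col w = i})" unfolding P_def by (simp add: card_PiE)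
  finally show ?thesis .
qed

text \<open>The product of the part sizes of the Turan graph on \<open>m\<close> vertices with \<open>p\<close> parts.\<close>

definition tau :: "nat \<Rightarrow> nat \<Rightarrow> nat" where
  "tau p m = (\<Prod>i<p. if i < m mod p then m div p + 1 else m div p)"

text \<open>For \<open>p = 0\<close> the residues \<open>u mod 0 = u\<close> are pairwise distinct, hence the case distinction.\<close>

definition core_graph :: "nat \<Rightarrow> nat \<Rightarrow> nat \<Rightarrow> nat graph" where
  "core_graph j p n = Graph {..<n} {{u, v} | u v. u < n \<and> v < n \<and> u \<noteq> v \<and>
     (if p = 0 then u < j \<and> v < j else u < j \<or> v < j \<or> (u - j) mod p \<noteq> (v - j) mod p)}"

lemma simple_core_graph: "simple_graph (core_graph j p n)"
  by (auto simp: simple_graph_def core_graph_def)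

lemma core_partite_core_graph:
  assumes "j \<le> n"
  shows "core_partite (adj (core_graph j p n)) {..<n} {..<j} (if p = 0 then {} else {j..<n}) (\<lambda>w. (w - j) mod p) p"
  using assms unfolding core_partite_def core_graph_def
  by (auto simp: doubleton_eq_iff)

section \<open>Joins and Turan graphs\<close>

lemma join_edge_simps [simp]:
  "{Inl a, Inl b} \<in> edges (graph_join G H) \<longleftrightarrow> {a, b} \<in> edges G"
  "{Inr c, Inr d} \<in> edges (graph_join G H) \<longleftrightarrow> {c, d} \<in> edges H"
  "{Inl a, Inr d} \<in> edges (graph_join G H) \<longleftrightarrow> a \<in> verts G \<and> d \<in> verts H"
  "{Inr d, Inl a} \<in> edges (graph_join G H) \<longleftrightarrow> a \<in> verts G \<and> d \<in> verts H"
proof -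
  have 1: "{Inl a, Inl b} = Inl ` {a, b}" "{Inr c, Inr d} = Inr ` {c, d}" by auto
  have 2: "Inl ` e \<in> image Inl ` E \<longleftrightarrow> e \<in> E" "Inr ` e' \<in> image Inr ` E' \<longleftrightarrow> e' \<in> E'"
    for e :: "'a set" and e' :: "'b set" and E E'
    by (auto simp: inj_image_eq_iff)
  have 3: "Inl ` {a, b} \<notin> image Inr ` E" "Inr ` {c, d} \<notin> image Inl ` E'" for E :: "'b set set" and E' :: "'a set set"
    by auto
  have 5: "Inl ` {a, b} \<notin> {{Inl u, Inr v} | u v. u \<in> verts G \<and> v \<in> verts H}"
    "Inr ` {c, d} \<notin> {{Inl u, Inr v} | u v. u \<in> verts G \<and> v \<in> verts H}" by (auto simp: doubleton_eq_iff)
  have 4: "{Inl a, Inr d} \<noteq> Inl ` e" "{Inl a, Inr d} \<noteq> Inr ` e'" for e e' by auto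
  show "{Inl a, Inl b} \<in> edges (graph_join G H) \<longleftrightarrow> {a, b} \<in> edges G"
    "{Inr c, Inr d} \<in> edges (graph_join G H) \<longleftrightarrow> {c, d} \<in> edges H"
    unfolding graph_join_def 1 using 5 by (simp_all only: graph.sel Un_iff 2 3 simp_thms)
  show "{Inl a, Inr d} \<in> edges (graph_join G H) \<longleftrightarrow> a \<in> verts G \<and> d \<in> verts H"
    using 4 unfolding graph_join_def by (auto simp: doubleton_eq_iff)
  then show "{Inr d, Inl a} \<in> edges (graph_join G H) \<longleftrightarrow> a \<in> verts G \<and> d \<in> verts H"
    by (simp add: insert_commute)
qed

lemma verts_join [simp]: "verts (graph_join G H) = Inl ` verts G \<union> Inr ` verts H"
  by (simp add: graph_join_def Plus_def)

lemma simple_graph_join: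
  assumes "simple_graph G" "simple_graph H"
  shows "simple_graph (graph_join G H)"
proof -
  have "e \<subseteq> verts (graph_join G H) \<and> card e = 2" if e: "e \<in> edges (graph_join G H)" for e
  proof -
    have G: "x \<subseteq> verts G \<and> card x = 2" if "x \<in> edges G" for x using that assms by (simp add: simple_graph_def)
    have H: "x \<subseteq> verts H \<and> card x = 2" if "x \<in> edges H" for x using that assms by (simp add: simple_graph_def)
    consider x where "x \<in> edges G" "e = Inl ` x" | x where "x \<in> edges H" "e = Inr ` x"
      | u v where "u \<in> verts G" "v \<in> verts H" "e = {Inl u, Inr v}"
      using e by (auto simp: graph_join_def)
    then show ?thesis
    proof cases
      case 1
      then show ?thesis using G[of x] by (auto simp: card_image)
    next
      case 2
      then show ?thesis using H[of x] by (auto simp: card_image)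
    next
      case 3
      then show ?thesis by auto
    qed
  qed
  then show ?thesis using assms by (simp add: simple_graph_def)
qed

lemma turan_edge: "{u, v} \<in> edges (turan_graph m p) \<longleftrightarrow> u < m \<and> v < m \<and> u mod p \<noteq> v mod p"
  by (auto simp: turan_graph_def doubleton_eq_iff)

lemma simple_turan_graph: "simple_graph (turan_graph m p)"
  by (auto simp: simple_graph_def turan_graph_def card_insert_if)

lemma core_partite_join:
  assumes "0 < p"
  shows "core_partite (adj (graph_join (complete_graph j) (turan_graph m p)))
    (verts (graph_join (complete_graph j) (turan_graph m p)))
    (Inl ` {..<j}) (Inr ` {..<m}) (\<lambda>x. case x of Inl u \<Rightarrow> 0 | Inr v \<Rightarrow> v mod p) p"
  using assms unfolding core_partite_def
  by (auto simp: turan_edge complete_graph_def turan_graph_def[of m p, THEN arg_cong[of _ _ verts]])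

lemma num_copies_join_turan:
  assumes "0 < p" "2 \<le> j + p"
  shows "num_copies (complete_graph (j + p)) (graph_join (complete_graph j) (turan_graph m p)) = tau p m"
proof -
  let ?G = "graph_join (complete_graph j) (turan_graph m p)"
  let ?col = "\<lambda>x. case x of Inl u \<Rightarrow> 0 | Inr v \<Rightarrow> v mod p"
  have cD: "card (Inl ` {..<j} :: (nat + nat) set) = j" by (simp add: card_image)
  have "simple_graph ?G"
    by (intro simple_graph_join simple_turan_graph) (simp add: complete_graph_def simple_clique_on)
  then have "num_copies (complete_graph (j + p)) ?G = card (cliques (adj ?G) (verts ?G) (j + p))"
    by (rule num_copies_complete_graph)
  also have "\<dots> = (\<Prod>i<p. card {w\<in>Inr ` {..<m} :: (nat + nat) set. ?col w = i})"
    using card_cliques_core_partite[OF core_partite_join[OF assms(1), of j m], unfolded cD] assms by simp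
  also have "\<dots> = tau p m" unfolding tau_def
  proof (intro prod.cong refl)
    fix i assume "i \<in> {..<p}"
    have "{w\<in>Inr ` {..<m} :: (nat + nat) set. ?col w = i} = Inr ` {v \<in> verts (turan_graph m p). v mod p = i}"
      by (auto simp: turan_graph_def)
    then show "card {w\<in>Inr ` {..<m} :: (nat + nat) set. ?col w = i} =
        (if i < m mod p then m div p + 1 else m div p)"
      using card_turan_part[of i p m] \<open>i \<in> {..<p}\<close> by (simp add: card_image)
  qed
  finally show ?thesis .
qed

text \<open>\<open>ex_num\<close> ranges over graphs on the naturals, whereas a join lives on a sum
  type; \<open>core_graph\<close> supplies the same count on \<open>{..<n}\<close> and also covers
  \<open>p = 0\<close>.\<close>

lemma num_copies_core_graph:
  assumes "2 \<le> j + p" "j \<le> n"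
  shows "num_copies (complete_graph (j + p)) (core_graph j p n) = tau p (n - j)"
proof -
  let ?W = "if p = 0 then {} else {j..<n}"
  have "num_copies (complete_graph (j + p)) (core_graph j p n)
      = card (cliques (adj (core_graph j p n)) {..<n} (j + p))"
    unfolding num_copies_complete_graph[OF simple_core_graph] by (simp add: core_graph_def)
  also have "\<dots> = (\<Prod>i<p. card {w\<in>?W. (w - j) mod p = i})"
    using card_cliques_core_partite[OF core_partite_core_graph[OF assms(2), of p]] assms(1) by simp
  also have "\<dots> = tau p (n - j)" unfolding tau_def
  proof (intro prod.cong refl)
    fix i assume i: "i \<in> {..<p}"
    then have "{w\<in>?W. (w - j) mod p = i} = (+) j ` {v \<in> verts (turan_graph (n - j) p). v mod p = i}"
    proof (intro set_eqI iffI)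
      fix w assume "w \<in> {w\<in>?W. (w - j) mod p = i}"
      then have "w - j \<in> {v \<in> verts (turan_graph (n - j) p). v mod p = i}" "w = j + (w - j)"
        using i by (auto simp: turan_graph_def)
      then show "w \<in> (+) j ` {v \<in> verts (turan_graph (n - j) p). v mod p = i}" by blast
    qed (use i in \<open>auto simp: turan_graph_def\<close>)
    then show "card {w\<in>?W. (w - j) mod p = i} = (if i < (n - j) mod p then (n - j) div p + 1 else (n - j) div p)"
      using card_turan_part[of i p "n - j"] i by (simp add: card_image)
  qed
  finally show ?thesis .
qed

lemma core_graph_free:
  assumes "j = s + 2 * t + 1" "r = p + s + t + 1" "2 \<le> r" "j \<le> n"
  shows "graph_free (book_graph r s) (core_graph j p n)"
proof -
  have "card (X \<inter> Y) \<noteq> s" if "X \<in> cliques (adj (core_graph j p n)) {..<n} r"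
    "Y \<in> cliques (adj (core_graph j p n)) {..<n} r" for X Y
    using core_partite_no_intersection[OF core_partite_core_graph[OF assms(4), of p] _ assms(2,3) that] assms(1)
    by simp
  moreover have "verts (core_graph j p n) = {..<n}" by (simp add: core_graph_def)
  ultimately show ?thesis using assms(2) by (subst graph_free_book_graph[OF simple_core_graph]) auto
qed

section \<open>Bounding the extremal number by clique counts\<close>

lemma ex_num_ge:
  assumes "j = s + 2 * t + 1" "r = p + s + t + 1" "2 \<le> r" "j \<le> n"
  shows "tau p (n - j) \<le> ex_num n (complete_graph (r + t)) (book_graph r s)"
  unfolding ex_num_def
proof (rule Max_ge[OF finite_ex_num_values])
  have eq: "r + t = j + p" "2 \<le> j + p" using assms by simp_all
  have "num_copies (complete_graph (r + t)) (core_graph j p n) = tau p (n - j)"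
    unfolding eq(1) by (rule num_copies_core_graph[OF eq(2) assms(4)])
  then show "tau p (n - j) \<in> {num_copies (complete_graph (r + t)) G |G :: nat graph.
      simple_graph G \<and> card (verts G) = n \<and> graph_free (book_graph r s) G}"
    using core_graph_free[OF assms] simple_core_graph
    by (intro CollectI exI[of _ "core_graph j p n"]) (simp add: core_graph_def)
qed

lemma ex_num_le:
  assumes s: "1 \<le> s" "s < r"
    and le: "\<And>G :: nat graph. finite (verts G) \<Longrightarrow> card (verts G) = n \<Longrightarrow>
      (\<And>X Y. X \<in> cliques (adj G) (verts G) r \<Longrightarrow> Y \<in> cliques (adj G) (verts G) r \<Longrightarrow> card (X \<inter> Y) \<noteq> s) \<Longrightarrow>
      card (cliques (adj G) (verts G) k) \<le> b"
  shows "ex_num n (complete_graph k) (book_graph r s) \<le> b"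
proof -
  let ?S = "{num_copies (complete_graph k) G | G :: nat graph.
    simple_graph G \<and> card (verts G) = n \<and> graph_free (book_graph r s) G}"
  have "?S \<noteq> {}"
  proof -
    \<comment> \<open>The edgeless graph shows that the maximum is over a nonempty set: it has no
      \<open>r\<close>-clique, since \<open>r \<ge> 2\<close>.\<close>
    let ?E = "Graph {..<n} {} :: nat graph"
    have sE: "simple_graph ?E" by (simp add: simple_graph_def)
    have "card (X \<inter> Y) \<noteq> s" if "X \<in> cliques (adj ?E) (verts ?E) r" "Y \<in> cliques (adj ?E) (verts ?E) r" for X Y
    proof -
      have "2 \<le> card X" "clq (adj ?E) X" using that s by (auto simp: cliques_def)
      then show ?thesis using card_le_Suc0_iff_eq[of X] card.infinite[of X] by (fastforce simp: clq_def)
    qed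
    then have "graph_free (book_graph r s) ?E"
      using graph_free_book_graph[OF sE, of s r] s by auto
    then have "num_copies (complete_graph k) ?E \<in> ?S" using sE by auto
    then show ?thesis by blast
  qed
  then have "ex_num n (complete_graph k) (book_graph r s) \<in> ?S"
    unfolding ex_num_def by (rule Max_in[OF finite_ex_num_values])
  then obtain G :: "nat graph" where G: "simple_graph G" "card (verts G) = n" "graph_free (book_graph r s) G"
    and eq: "ex_num n (complete_graph k) (book_graph r s) = num_copies (complete_graph k) G" by auto
  have "card (cliques (adj G) (verts G) k) \<le> b"
  proof (rule le)
    show "finite (verts G)" using G(1) by (simp add: simple_graph_def)
  qed (use G graph_free_book_graph[OF G(1), of s r] s in auto)
  then show ?thesis using eq num_copies_complete_graph[OF G(1)] by simp
qed

section \<open>Cliques in clique-free graphs\<close>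

text \<open>This is \<open>a \<le> q (1 + 1/q)\<^bsup>a-q\<^esup>\<close> without division, with equality for \<open>a = q\<close> and \<open>a = q + 1\<close>.\<close>

lemma tangent_power_ineq:
  fixes a q :: nat
  shows "a * (q ^ a * (q + 1) ^ q) \<le> q ^ (q + 1) * (q + 1) ^ a"
proof (cases "q \<le> a")
  case True
  then show ?thesis
  proof (induction a rule: dec_induct)
    case (step a)
    have "Suc a * (q ^ Suc a * (q + 1) ^ q) = (Suc a * q) * (q ^ a * (q + 1) ^ q)" by (simp only: power_Suc ac_simps)
    also have "\<dots> \<le> (a * (q + 1)) * (q ^ a * (q + 1) ^ q)"
      using step by (intro mult_le_mono1) simp
    also have "\<dots> = (q + 1) * (a * (q ^ a * (q + 1) ^ q))" by (simp only: ac_simps)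
    also have "\<dots> \<le> (q + 1) * (q ^ (q + 1) * (q + 1) ^ a)" using step by (intro mult_le_mono2)
    also have "\<dots> = q ^ (q + 1) * (q + 1) ^ Suc a" by (simp only: power_Suc ac_simps)
    finally show ?case .
  qed simp
next
  case False
  then have "a \<le> q" by simp
  then show ?thesis
  proof (induction a rule: inc_induct)
    case (step a)
    have "(q + 1) * (a * (q ^ a * (q + 1) ^ q)) = (a * (q + 1)) * (q ^ a * (q + 1) ^ q)" by (simp only: ac_simps)
    also have "\<dots> \<le> (Suc a * q) * (q ^ a * (q + 1) ^ q)"
      using step by (intro mult_le_mono1) simp
    also have "\<dots> = Suc a * (q ^ Suc a * (q + 1) ^ q)" by (simp only: power_Suc ac_simps)
    also have "\<dots> \<le> q ^ (q + 1) * (q + 1) ^ Suc a" by (rule step.IH)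
    also have "\<dots> = (q + 1) * (q ^ (q + 1) * (q + 1) ^ a)" by (simp only: power_Suc ac_simps)
    finally show ?case by (simp only: mult_le_cancel1)
  qed simp
qed

lemma tau_eq:
  assumes "0 < p"
  shows "tau p m = (m div p) ^ (p - m mod p) * (m div p + 1) ^ (m mod p)"
proof -
  let ?e = "m mod p"
  have e: "?e \<le> p" using assms by (simp add: less_imp_le)
  have "tau p m = (\<Prod>i\<in>{..<?e}. m div p + 1) * (\<Prod>i\<in>{?e..<p}. m div p)"
  proof -
    have "tau p m = (\<Prod>i\<in>{..<?e} \<union> {?e..<p}. if i < ?e then m div p + 1 else m div p)"
      unfolding tau_def using e by (intro prod.cong) auto
    also have "\<dots> = (\<Prod>i\<in>{..<?e}. if i < ?e then m div p + 1 else m div p) *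
        (\<Prod>i\<in>{?e..<p}. if i < ?e then m div p + 1 else m div p)"
      by (intro prod.union_disjoint) auto
    finally show ?thesis by simp
  qed
  then show ?thesis by simp
qed

text \<open>Multiply \<open>tangent_power_ineq\<close> at the rounded-down mean \<open>q\<close>
  over all factors. It is tight at \<open>q\<close> and \<open>q + 1\<close>, so the balanced
  product is optimal. If \<open>q = 0\<close>, the sum is below \<open>p\<close> and some factor
  vanishes.\<close>

lemma prod_le_tau:
  fixes a :: "nat \<Rightarrow> nat"
  assumes p: "0 < p"
  shows "(\<Prod>i<p. a i) \<le> tau p (\<Sum>i<p. a i)"
proof -
  define S where "S = (\<Sum>i<p. a i)"
  define q where "q = S div p"
  define e where "e = S mod p"
  have S: "S = p * q + e" by (simp add: q_def e_def)
  have e: "e < p" using p by (simp add: e_def)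
  show ?thesis
  proof (cases "q = 0")
    case True
    have "\<exists>i<p. a i = 0"
    proof (rule ccontr)
      assume "\<not> ?thesis"
      then have "(\<Sum>i<p. 1) \<le> (\<Sum>i<p. a i)" by (intro sum_mono) (auto simp: Suc_le_eq)
      then show False using S True e unfolding S_def by simp
    qed
    then have "(\<Prod>i<p. a i) = 0" by auto
    then show ?thesis by (simp only: le0)
  next
    case False
    let ?b = "q ^ (p * q) * (q + 1) ^ (p * q) * q ^ e"
    have "(\<Prod>i<p. a i * (q ^ a i * (q + 1) ^ q)) \<le> (\<Prod>i<p. q ^ (q + 1) * (q + 1) ^ a i)"
      by (intro prod_mono conjI tangent_power_ineq) simp
    then have "(\<Prod>i<p. a i) * (q ^ S * (q + 1) ^ (q * p)) \<le> q ^ ((q + 1) * p) * (q + 1) ^ S"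
      unfolding S_def by (simp only: prod.distrib power_sum prod_constant card_lessThan power_mult)
    moreover have "q ^ S * (q + 1) ^ (q * p) = ?b"
      unfolding S by (simp only: power_add ac_simps)
    moreover have "q ^ ((q + 1) * p) * (q + 1) ^ S = q ^ (p - e) * (q + 1) ^ e * ?b"
    proof -
      have "(q + 1) * p = (p - e) + p * q + e" using e by (simp add: algebra_simps)
      then show ?thesis unfolding S by (simp only: power_add ac_simps)
    qed
    ultimately have "(\<Prod>i<p. a i) * ?b \<le> q ^ (p - e) * (q + 1) ^ e * ?b" by simp
    moreover have "0 < ?b" using False by simp
    ultimately have "(\<Prod>i<p. a i) \<le> q ^ (p - e) * (q + 1) ^ e" by (simp only: mult_le_cancel2)
    then show ?thesis unfolding tau_eq[OF p] S_def[symmetric] q_def e_def .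
  qed
qed

text \<open>Enlarging a smallest part, here the one with index \<open>m mod p\<close>, by one vertex
  adds the product of the other \<open>p - 1\<close> parts, each at least \<open>m div p\<close>.
  The new product is compared with \<open>tau\<close> through \<open>prod_le_tau\<close>.\<close>

lemma tau_Suc:
  assumes p: "0 < p"
  shows "tau p m + (m div p) ^ (p - 1) \<le> tau p (Suc m)"
proof -
  let ?e = "m mod p"
  define b where "b i = (if i < ?e then m div p + 1 else m div p)" for i
  have e: "?e < p" using p by simp
  have split: "{..<p} = insert ?e ({..<p} - {?e})" using e by auto
  have sb: "(\<Sum>i<p. b i) = m"
  proof -
    have "(\<Sum>i<p. b i) = (\<Sum>i<p. m div p + (if i < ?e then 1 else 0))"
      by (intro sum.cong) (auto simp: b_def)
    also have "\<dots> = p * (m div p) + card {i\<in>{..<p}. i < ?e}"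
      by (simp add: sum.distrib sum.If_cases Int_def)
    also have "{i\<in>{..<p}. i < ?e} = {..<?e}" using e by auto
    finally show ?thesis by simp
  qed
  define c where "c = b(?e := b ?e + 1)"
  have pr: "(\<Prod>i<p. b i) = b ?e * (\<Prod>i\<in>{..<p} - {?e}. b i)"
    using e by (subst split, subst prod.insert) auto
  have prc: "(\<Prod>i<p. c i) = (b ?e + 1) * (\<Prod>i\<in>{..<p} - {?e}. b i)"
  proof -
    have "(\<Prod>i<p. c i) = c ?e * (\<Prod>i\<in>{..<p} - {?e}. c i)"
      using e by (subst split, subst prod.insert) auto
    also have "(\<Prod>i\<in>{..<p} - {?e}. c i) = (\<Prod>i\<in>{..<p} - {?e}. b i)"
      by (intro prod.cong) (auto simp: c_def)
    finally show ?thesis by (simp add: c_def)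
  qed
  have "(\<Sum>i<p. c i) = c ?e + (\<Sum>i\<in>{..<p} - {?e}. c i)"
    using e by (subst split, subst sum.insert) auto
  also have "(\<Sum>i\<in>{..<p} - {?e}. c i) = (\<Sum>i\<in>{..<p} - {?e}. b i)"
    by (intro sum.cong) (auto simp: c_def)
  also have "c ?e + \<dots> = Suc (b ?e + (\<Sum>i\<in>{..<p} - {?e}. b i))" by (simp add: c_def)
  also have "b ?e + (\<Sum>i\<in>{..<p} - {?e}. b i) = (\<Sum>i<p. b i)"
    using e by (subst (2) split, subst sum.insert) auto
  finally have sc: "(\<Sum>i<p. c i) = Suc m" using sb by simp
  have "(m div p) ^ (p - 1) = (\<Prod>i\<in>{..<p} - {?e}. m div p)" using e by simp
  also have "\<dots> \<le> (\<Prod>i\<in>{..<p} - {?e}. b i)" by (intro prod_mono) (auto simp: b_def)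
  finally have "tau p m + (m div p) ^ (p - 1) \<le> (\<Prod>i<p. c i)"
    unfolding tau_def b_def[symmetric] pr prc by simp
  also have "\<dots> \<le> tau p (Suc m)" using prod_le_tau[OF p, of c] sc by simp
  finally show ?thesis .
qed

lemma tau_mono:
  assumes "0 < p" "m \<le> n"
  shows "tau p m \<le> tau p n"
  using assms(2) by (rule lift_Suc_mono_le[rotated]) (use tau_Suc[OF assms(1)] in \<open>meson add_leD1\<close>)

lemma tau_ge: "(m div p) ^ p \<le> tau p m"
proof -
  have "(m div p) ^ p = (\<Prod>i<p. m div p)" by simp
  also have "\<dots> \<le> tau p m" unfolding tau_def by (intro prod_mono) auto
  finally show ?thesis .
qed

text \<open>The inequality of the arithmetic and geometric means, from
  \<open>1 + y \<le> exp y\<close>: with \<open>x\<close> the mean, the exponents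
  \<open>b i / x - 1\<close> sum to zero.\<close>

lemma tau_le:
  assumes p: "0 < p"
  shows "real (tau p m) \<le> (real m / p) ^ p"
proof (cases "m = 0")
  case True
  then show ?thesis using p by (simp add: tau_def zero_power)
next
  case False
  define x where "x = real m / p"
  have x: "x > 0" using False p by (simp add: x_def)
  define b where "b i = (if i < m mod p then m div p + 1 else m div p)" for i
  have "real (tau p m) = (\<Prod>i<p. real (b i))" unfolding tau_def b_def by simp
  also have "\<dots> \<le> (\<Prod>i<p. x * exp (b i / x - 1))"
  proof (intro prod_mono conjI)
    fix i
    have "x * (1 + (b i / x - 1)) \<le> x * exp (b i / x - 1)"
      using x by (intro mult_left_mono exp_ge_add_one_self) auto
    then show "real (b i) \<le> x * exp (b i / x - 1)" using x by simp
  qed simp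
  also have "\<dots> = x ^ p * exp (\<Sum>i<p. b i / x - 1)"
    by (simp add: prod.distrib exp_sum)
  also have "(\<Sum>i<p. b i / x - 1) = (\<Sum>i<p. b i) / x - p"
    by (simp add: sum_subtractf sum_divide_distrib)
  also have "(\<Sum>i<p. b i) = m"
  proof -
    have "(\<Sum>i<p. b i) = (\<Sum>i<p. m div p + (if i < m mod p then 1 else 0))"
      by (intro sum.cong) (auto simp: b_def)
    also have "\<dots> = p * (m div p) + card {i\<in>{..<p}. i < m mod p}"
      by (simp add: sum.distrib sum.If_cases Int_def)
    also have "{i\<in>{..<p}. i < m mod p} = {..<m mod p}" using p by (auto intro: less_trans)
    finally show ?thesis by simp
  qed
  also have "real m / x - p = 0" using False p by (simp add: x_def)
  finally show ?thesis by (simp add: x_def)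
qed

text \<open>Zykov's bound by induction: a \<open>p\<close>-clique leaves the \<open>K\<^sub>p\<close>-free neighbourhood of a vertex
  of maximal clique degree.\<close>

lemma zykov_bound:
  assumes "finite V" "\<And>u v. E u v \<Longrightarrow> E v u" "cliques E V (p + 1) = {}"
  shows "\<exists>a. (\<Sum>i<p. a i) = card V \<and> card (cliques E V p) \<le> (\<Prod>i<p. a i)"
  using assms(1,3)
proof (induction p arbitrary: V)
  case 0
  have "V = {}"
  proof (rule ccontr)
    assume "V \<noteq> {}"
    then obtain v where "v \<in> V" by blast
    then have "{v} \<in> cliques E V (0 + 1)" by (simp add: cliques_def clq_def)
    then show False using 0 by blast
  qed
  moreover have "cliques E {} 0 = {{}}" by (auto simp: cliques_def clq_def)
  ultimately show ?case by simp
next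
  case (Suc p)
  define N where "N u = {w\<in>V. w \<noteq> u \<and> E u w}" for u
  define deg where "deg u = card (cliques E (N u) p)" for u
  have fN: "finite (N u)" for u using Suc.prems by (simp add: N_def)
  show ?case
  proof (cases "V = {}")
    case True
    then have "cliques E V (Suc p) = {}" by (auto simp: cliques_def)
    then show ?thesis using True by (intro exI[of _ "\<lambda>_. 0"]) simp
  next
    case False
    have "Max (deg ` V) \<in> deg ` V" using Suc.prems False by (intro Max_in) auto
    then obtain v where v: "v \<in> V" and "deg v = Max (deg ` V)" by auto
    then have max: "deg u \<le> deg v" if "u \<in> V" for u using that Suc.prems by simp
    have Nfree: "cliques E (N v) (p + 1) = {}"
    proof (rule ccontr)
      assume "\<not> ?thesis"
      then obtain X where X: "X \<subseteq> N v" "card X = p + 1" "clq E X" by (auto simp: cliques_def)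
      have "finite X" using X fN finite_subset by blast
      moreover have "v \<notin> X" using X by (auto simp: N_def)
      moreover have "clq E (insert v X)" using X assms(2) unfolding clq_def N_def by blast
      ultimately have "insert v X \<in> cliques E V (Suc p + 1)"
        using X v by (auto simp: cliques_def N_def)
      then show False using Suc.prems by blast
    qed
    then obtain a where a: "(\<Sum>i<p. a i) = card (N v)" "deg v \<le> (\<Prod>i<p. a i)"
      using Suc.IH[OF fN] unfolding deg_def by blast
    have "cliques E V (Suc p) \<subseteq> (\<Union>u\<in>V - N v. insert u ` cliques E (N u) p)"
    proof
      fix X assume "X \<in> cliques E V (Suc p)"
      then have X: "X \<subseteq> V" "card X = Suc p" "clq E X" by (auto simp: cliques_def)
      have fX: "finite X" using X Suc.prems finite_subset by blast
      \<comment> \<open>So every clique has a vertex \<open>u\<close> outside \<open>N v\<close>,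
        and there are at most \<open>deg u \<le> deg v\<close> cliques through each such
        \<open>u\<close>. The set \<open>V - N v\<close> becomes the new part.\<close>
      have "\<not> X \<subseteq> N v" using X Nfree by (auto simp: cliques_def)
      then obtain u where u: "u \<in> X" "u \<notin> N v" by blast
      have "X - {u} \<in> cliques E (N u) p"
        using X u fX clq_subset[OF X(3), of "X - {u}"] by (auto simp: cliques_def N_def clq_def)
      moreover have "X = insert u (X - {u})" using u by blast
      ultimately show "X \<in> (\<Union>u\<in>V - N v. insert u ` cliques E (N u) p)" using u X by blast
    qed
    then have "card (cliques E V (Suc p)) \<le> card (\<Union>u\<in>V - N v. insert u ` cliques E (N u) p)"
      using Suc.prems fN by (intro card_mono) (auto simp: finite_cliques)
    also have "\<dots> \<le> (\<Sum>u\<in>V - N v. card (insert u ` cliques E (N u) p))"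
      using Suc.prems by (intro card_UN_le) simp
    also have "\<dots> \<le> (\<Sum>u\<in>V - N v. deg v)"
    proof (intro sum_mono)
      fix u assume u: "u \<in> V - N v"
      have "card (insert u ` cliques E (N u) p) \<le> deg u"
        unfolding deg_def by (intro card_image_le finite_cliques fN)
      then show "card (insert u ` cliques E (N u) p) \<le> deg v" using max[of u] u by simp
    qed
    also have "\<dots> \<le> card (V - N v) * (\<Prod>i<p. a i)" using a by simp
    also have "\<dots> = (\<Prod>i<Suc p. (a(p := card (V - N v))) i)" by simp
    finally have "card (cliques E V (Suc p)) \<le> (\<Prod>i<Suc p. (a(p := card (V - N v))) i)" .
    moreover have "(\<Sum>i<Suc p. (a(p := card (V - N v))) i) = card V"
    proof -
      have "N v \<subseteq> V" by (auto simp: N_def)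
      then show ?thesis using a(1) Suc.prems fN card_mono[of V "N v"] by (simp add: card_Diff_subset)
    qed
    ultimately show ?thesis by blast
  qed
qed

lemma card_cliques_le_tau:
  assumes "finite V" "\<And>u v. E u v \<Longrightarrow> E v u" "cliques E V (p + 1) = {}" "0 < p"
  shows "card (cliques E V p) \<le> tau p (card V)"
  using zykov_bound[OF assms(1-3)] prod_le_tau[OF assms(4)] by (metis order_trans)

section \<open>Families with intersections empty or large\<close>

lemma card_UN_le_real:
  assumes "finite I" "real (card I) \<le> c" "0 \<le> b" "\<And>i. i \<in> I \<Longrightarrow> real (card (X i)) \<le> b"
  shows "real (card (\<Union>i\<in>I. X i)) \<le> c * b"
proof -
  have "real (card (\<Union>i\<in>I. X i)) \<le> real (\<Sum>i\<in>I. card (X i))"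
    using card_UN_le[OF assms(1), of X] by (simp only: of_nat_le_iff)
  also have "\<dots> \<le> (\<Sum>i\<in>I. b)" unfolding of_nat_sum by (intro sum_mono assms(4))
  also have "\<dots> = card I * b" by simp
  also have "\<dots> \<le> c * b" by (intro mult_right_mono assms)
  finally show ?thesis .
qed

text \<open>A member containing \<open>T\<close> is determined by its remaining points. The quotient
  form stays meaningful for \<open>m > k\<close>, where truncated subtraction in the exponent would
  not; then \<open>T\<close> lies in no member.\<close>

lemma card_supersets_le:
  assumes V: "finite V" "V \<noteq> {}" and F: "\<And>A. A \<in> F \<Longrightarrow> A \<subseteq> V \<and> card A = k"
    and T: "m \<le> card T"
  shows "real (card {A\<in>F. T \<subseteq> A}) \<le> card V ^ k / card V ^ m"
proof (cases "finite T \<and> card T \<le> k")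
  case True
  have "0 < card V" using V by (simp add: card_gt_0_iff)
  then have n1: "1 \<le> real (card V)" by simp
  have "inj_on (\<lambda>A. A - T) {A\<in>F. T \<subseteq> A}" by (rule inj_onI) auto
  then have "card {A\<in>F. T \<subseteq> A} = card ((\<lambda>A. A - T) ` {A\<in>F. T \<subseteq> A})" by (simp add: card_image)
  also have "\<dots> \<le> card {Q. Q \<subseteq> V \<and> card Q = k - card T}"
    using V F True by (intro card_mono) (auto simp: card_Diff_subset)
  also have "\<dots> \<le> card V ^ (k - card T)" by (rule card_subsets_of_card_le[OF V(1)])
  finally have "real (card {A\<in>F. T \<subseteq> A}) \<le> real (card V) ^ (k - card T)"
    by (metis of_nat_le_iff of_nat_power)
  also have "\<dots> = real (card V) ^ k / real (card V) ^ card T"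
    using True V by (subst power_diff) auto
  also have "\<dots> \<le> real (card V) ^ k / real (card V) ^ m"
    using n1 T by (intro divide_left_mono power_increasing mult_pos_pos zero_less_power) auto
  finally show ?thesis by simp
next
  case False
  have "\<not> T \<subseteq> A" if A: "A \<in> F" for A
  proof
    assume TA: "T \<subseteq> A"
    have "finite A" using F[OF A] V finite_subset by blast
    then have "finite T" "card T \<le> k" using TA finite_subset card_mono F[OF A] by blast+
    then show False using False by simp
  qed
  then have "{A\<in>F. T \<subseteq> A} = {}" by blast
  then have "card {A\<in>F. T \<subseteq> A} = 0" by (simp only: card.empty)
  then show ?thesis by (simp only: of_nat_0) simp
qed

text \<open>The situation for \<open>s = 1\<close>, where the gap leaves only intersections that are
  empty or of size at least \<open>j\<close>. It is stated for set families because the bound on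
  scattered sets uses no edges.\<close>

locale gap_family =
  fixes V :: "'a set" and F :: "'a set set" and p j :: nat
  assumes finV: "finite V"
    and F: "\<And>A. A \<in> F \<Longrightarrow> A \<subseteq> V \<and> card A = p + j"
    and meet: "\<And>A B. A \<in> F \<Longrightarrow> B \<in> F \<Longrightarrow> A \<inter> B \<noteq> {} \<Longrightarrow> j \<le> card (A \<inter> B)"
    and p2: "2 \<le> p" and j1: "1 \<le> j"
begin

definition good :: "'a set \<Rightarrow> bool" where
  "good D \<longleftrightarrow> card D = j \<and> (\<forall>B\<in>F. B \<inter> D \<noteq> {} \<longrightarrow> D \<subseteq> B)"

definition scattered :: "'a set set" where
  "scattered = {A\<in>F. \<forall>D\<subseteq>A. \<not> good D}"

lemma finite_member: "A \<in> F \<Longrightarrow> finite A"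
  using F finV finite_subset by blast

lemma scattered_subset: "scattered \<subseteq> F"
  by (auto simp: scattered_def)

lemma finite_scattered: "finite scattered"
  using F finV by (intro finite_subset[of scattered "Pow V"]) (auto simp: scattered_def)

text \<open>Fix \<open>A0\<close> through \<open>v\<close>. Any \<open>A\<close> through \<open>v\<close> contains a \<open>j\<close>-set \<open>D \<subseteq> A0\<close>. As \<open>D\<close> is not good, some \<open>B\<close>
  meets \<open>D\<close> without containing it, and \<open>A\<close> must contain a point of \<open>B - D\<close>.\<close>

lemma scattered_cover:
  "\<exists>S. finite S \<and> card S \<le> 2 ^ (p + j) * (p + j) \<and> (\<forall>T\<in>S. card T = Suc j \<and> v \<in> T) \<and>
    (\<forall>A\<in>scattered. v \<in> A \<longrightarrow> (\<exists>T\<in>S. T \<subseteq> A))"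
proof (cases "\<exists>A\<in>scattered. v \<in> A")
  case False
  then show ?thesis by (intro exI[of _ "{}"]) auto
next
  case True
  then obtain A0 where A0: "A0 \<in> scattered" "v \<in> A0" by blast
  have A0F: "A0 \<in> F" "finite A0" "card A0 = p + j" using A0 scattered_subset finite_member F by auto
  define DD where "DD = {D\<in>Pow A0. card D = j \<and> v \<in> D}"
  have fD: "finite DD" using A0F by (simp add: DD_def)
  have cD: "card DD \<le> 2 ^ (p + j)"
    using card_mono[of "Pow A0" DD] A0F by (auto simp: DD_def card_Pow)
  have "\<exists>B\<in>F. B \<inter> D \<noteq> {} \<and> \<not> D \<subseteq> B" if "D \<in> DD" for D
    using that A0(1) unfolding DD_def scattered_def good_def by auto
  then obtain B where B: "\<And>D. D \<in> DD \<Longrightarrow> B D \<in> F \<and> B D \<inter> D \<noteq> {} \<and> \<not> D \<subseteq> B D" by metis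
  define S where "S = (\<Union>D\<in>DD. (\<lambda>y. insert y D) ` (B D - D))"
  have fB: "finite (B D - D)" "card (B D - D) \<le> p + j" if "D \<in> DD" for D
  proof -
    have "B D \<in> F" using B[OF that] by simp
    then show "finite (B D - D)" "card (B D - D) \<le> p + j"
      using finite_member[of "B D"] F[of "B D"] card_mono[of "B D" "B D - D"] by auto
  qed
  have "card S \<le> (\<Sum>D\<in>DD. card ((\<lambda>y. insert y D) ` (B D - D)))"
    unfolding S_def by (rule card_UN_le[OF fD])
  also have "\<dots> \<le> (\<Sum>D\<in>DD. p + j)"
    using fB card_image_le order_trans by (intro sum_mono) blast
  also have "\<dots> \<le> 2 ^ (p + j) * (p + j)" using cD by simp
  finally have cS: "card S \<le> 2 ^ (p + j) * (p + j)" .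
  have fS: "finite S" unfolding S_def using fD fB by auto
  have TS: "card T = Suc j \<and> v \<in> T" if T: "T \<in> S" for T
  proof -
    obtain D y where D: "D \<in> DD" "y \<in> B D - D" "T = insert y D" using T by (auto simp: S_def)
    have "finite D" using D(1) A0F finite_subset unfolding DD_def by blast
    then show ?thesis using D by (auto simp: DD_def)
  qed
  have "\<exists>T\<in>S. T \<subseteq> A" if A: "A \<in> scattered" "v \<in> A" for A
  proof -
    have AF: "A \<in> F" using A scattered_subset by blast
    have "j \<le> card (A \<inter> A0)" using meet[OF AF A0F(1)] A A0 by blast
    then have "\<exists>D. {v} \<subseteq> D \<and> D \<subseteq> A \<inter> A0 \<and> card D = j"
      using A A0 A0F j1 by (intro exists_subset_between) auto
    then obtain D where D: "v \<in> D" "D \<subseteq> A" "D \<subseteq> A0" "card D = j" by auto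
    have DD: "D \<in> DD" using D by (auto simp: DD_def)
    note BD = B[OF DD]
    have fDD: "finite D" using D A0F finite_subset by blast
    \<comment> \<open>\<open>B D\<close> meets \<open>D \<subseteq> A\<close>, so it shares at least
      \<open>j\<close> points with \<open>A\<close>; fewer than \<open>j\<close> of them lie in
      \<open>D\<close>.\<close>
    have "j \<le> card (A \<inter> B D)" using meet[OF AF, of "B D"] BD D by blast
    moreover have "card (D \<inter> B D) < j"
      using psubset_card_mono[of D "D \<inter> B D"] BD D fDD by auto
    ultimately have "\<not> A \<inter> B D \<subseteq> D \<inter> B D"
      using card_mono[of "D \<inter> B D" "A \<inter> B D"] fDD by auto
    then obtain y where "y \<in> A" "y \<in> B D" "y \<notin> D" by blast
    then show ?thesis using D DD unfolding S_def by (intro bexI[of _ "insert y D"]) auto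
  qed
  then show ?thesis using cS fS TS by blast
qed

text \<open>Each clique is covered by the \<open>(j+1)\<close>-sets of \<open>scattered_cover\<close>. Those of large degree are boundedly
  many through each point, so two of them in one clique save a factor \<open>n\<close>; \<open>\<epsilon>\<close> is the threshold.\<close>

lemma card_scattered_le:
  assumes eps: "\<epsilon> > 0" and ne: "V \<noteq> {}"
  defines "c \<equiv> real (2 ^ (p + j) * (p + j))"
  shows "real (card scattered) \<le> c * \<epsilon> * card V ^ p +
    (c * (real (Suc j) * (2 ^ (p + j) * c / \<epsilon>)) + c\<^sup>2) * card V ^ (p - 1)"
proof -
  let ?n = "real (card V)"
  let ?k = "p + j"
  have "0 < card V" using finV ne by (simp add: card_gt_0_iff)
  then have n1: "1 \<le> ?n" by simp
  have c0: "0 \<le> c" by (simp add: c_def)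
  have sF: "A \<subseteq> V \<and> card A = ?k" if "A \<in> scattered" for A using that F scattered_subset by blast
  define sup where "sup T = {A\<in>scattered. T \<subseteq> A}" for T
  have sup_le: "real (card (sup T)) \<le> ?n ^ ?k / ?n ^ m" if "m \<le> card T" for T m
    using card_supersets_le[OF finV ne sF that] by (simp add: sup_def)
  define N where "N = ?n ^ (p - 1)"
  have N0: "N > 0" using n1 by (simp add: N_def)
  have powN: "?n ^ ?k / ?n ^ (Suc j) = N" "?n ^ ?k / ?n ^ (j + 2) = N / ?n" "?n ^ ?k / ?n ^ (j + 3) = N / (?n * ?n)"
  proof -
    have "?n ^ ?k = N * ?n ^ Suc j" unfolding N_def using p2
      by (subst power_add[symmetric]) (intro arg_cong[of _ _ "power _"], simp)
    then show "?n ^ ?k / ?n ^ (Suc j) = N" "?n ^ ?k / ?n ^ (j + 2) = N / ?n" "?n ^ ?k / ?n ^ (j + 3) = N / (?n * ?n)"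
      using n1 by (simp_all add: field_simps numeral_eq_Suc)
  qed
  obtain S where S: "\<And>v. finite (S v)" "\<And>v. card (S v) \<le> 2 ^ ?k * ?k"
    "\<And>v T. T \<in> S v \<Longrightarrow> card T = Suc j \<and> v \<in> T"
    "\<And>v A. A \<in> scattered \<Longrightarrow> v \<in> A \<Longrightarrow> \<exists>T\<in>S v. T \<subseteq> A"
    using scattered_cover by metis
  have cS: "real (card (S v)) \<le> c" for v unfolding c_def using S(2)[of v] by (simp only: of_nat_le_iff)
  have fsup: "finite (sup T)" for T using finite_scattered by (simp add: sup_def)
  have deg: "real (card {A\<in>scattered. v \<in> A}) \<le> c * N" for v
  proof -
    have "{A\<in>scattered. v \<in> A} \<subseteq> (\<Union>T\<in>S v. sup T)" using S(4) by (auto simp: sup_def)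
    then have "card {A\<in>scattered. v \<in> A} \<le> card (\<Union>T\<in>S v. sup T)"
      using S(1) fsup by (intro card_mono) auto
    moreover have "real (card (\<Union>T\<in>S v. sup T)) \<le> c * N"
      using S(1) cS N0 S(3) sup_le[of "Suc j"] powN(1) by (intro card_UN_le_real) auto
    ultimately show ?thesis by simp
  qed
  define heavy where "heavy T \<longleftrightarrow> \<epsilon> * N < real (card (sup T))" for T
  define H where "H y = {T. T \<subseteq> V \<and> y \<in> T \<and> card T = Suc j \<and> heavy T}" for y
  have fH: "finite (H y)" for y using finV by (intro finite_subset[of "H y" "Pow V"]) (auto simp: H_def)
  \<comment> \<open>Double count pairs of a heavy \<open>T\<close> through \<open>y\<close> and a
    scattered set containing it: each \<open>T\<close> is in more than \<open>\<epsilon> * N\<close>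
    of them, and each set contains at most \<open>2 ^ (p + j)\<close> candidates.\<close>
  have cH: "real (card (H y)) \<le> 2 ^ ?k * c / \<epsilon>" for y
  proof -
    let ?G = "{A\<in>scattered. y \<in> A}"
    have fG: "finite ?G" using finite_scattered by simp
    have "real (card (H y)) * (\<epsilon> * N) = (\<Sum>T\<in>H y. \<epsilon> * N)" by simp
    also have "\<dots> \<le> (\<Sum>T\<in>H y. real (card (sup T)))"
      by (intro sum_mono) (auto simp: H_def heavy_def)
    also have "\<dots> = (\<Sum>T\<in>H y. \<Sum>A\<in>?G. if T \<subseteq> A then 1 else 0)"
    proof (rule sum.cong[OF refl])
      fix T assume T: "T \<in> H y"
      have "sup T = {A\<in>?G. T \<subseteq> A}" using T by (auto simp: sup_def H_def)
      then show "real (card (sup T)) = (\<Sum>A\<in>?G. if T \<subseteq> A then 1 else 0)"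
        using fG by (simp add: sum.If_cases Int_def)
    qed
    also have "\<dots> = (\<Sum>A\<in>?G. \<Sum>T\<in>H y. if T \<subseteq> A then 1 else 0)" by (rule sum.swap)
    also have "\<dots> \<le> (\<Sum>A\<in>?G. 2 ^ ?k)"
    proof (rule sum_mono)
      fix A assume A: "A \<in> ?G"
      have "finite A" "card A = ?k" using A sF[of A] finite_subset[OF _ finV] by auto
      then have "card {T\<in>H y. T \<subseteq> A} \<le> card (Pow A)" by (intro card_mono) auto
      also have "\<dots> = 2 ^ ?k" using \<open>finite A\<close> \<open>card A = ?k\<close> by (simp add: card_Pow)
      finally have "real (card {T\<in>H y. T \<subseteq> A}) \<le> 2 ^ ?k" by simp
      then show "(\<Sum>T\<in>H y. if T \<subseteq> A then 1 else 0) \<le> (2::real) ^ ?k"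
        using fH by (simp add: sum.If_cases Int_def)
    qed
    also have "\<dots> = 2 ^ ?k * real (card ?G)" by simp
    also have "\<dots> \<le> 2 ^ ?k * (c * N)" using deg[of y] by (intro mult_left_mono) auto
    finally have "real (card (H y)) * \<epsilon> * N \<le> 2 ^ ?k * c * N" by (simp add: mult.assoc)
    then have "real (card (H y)) * \<epsilon> \<le> 2 ^ ?k * c" using N0 by (simp only: mult_le_cancel_right)
    then show ?thesis using eps by (simp add: field_simps)
  qed
  \<comment> \<open>Three ways to cover a scattered set: by a light set (\<open>L\<close>), by two
    sets of which the second is heavy and meets the first in \<open>y\<close> (\<open>M\<close>), or
    by two disjoint sets (\<open>P\<close>). The unions have at least \<open>j + 2\<close> points in
    \<open>M\<close> and \<open>2 * j + 2 \<ge> j + 3\<close> points in \<open>P\<close>, which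
    offsets the extra choices.\<close>
  define L where "L = (\<Union>v\<in>V. \<Union>T\<in>{T\<in>S v. \<not> heavy T}. sup T)"
  define M where "M = (\<Union>v\<in>V. \<Union>T\<in>S v. \<Union>y\<in>T. \<Union>T'\<in>{T'\<in>H y. \<not> T' \<subseteq> T}. sup (T \<union> T'))"
  define P where "P = (\<Union>v\<in>V. \<Union>T\<in>S v. \<Union>z\<in>V. \<Union>T'\<in>{T'\<in>S z. T \<inter> T' = {}}. sup (T \<union> T'))"
  have fT: "finite T" if "T \<in> S v" for T v using S(3)[OF that] card_ge_0_finite[of T] by simp
  have cL: "real (card L) \<le> ?n * (c * (\<epsilon> * N))" unfolding L_def
  proof (intro card_UN_le_real)
    fix v
    show "real (card {T\<in>S v. \<not> heavy T}) \<le> c"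
      using card_mono[OF S(1)[of v], of "{T\<in>S v. \<not> heavy T}"] cS[of v] by (auto intro: order_trans[rotated])
  qed (use finV S(1) c0 eps N0 in \<open>auto simp: heavy_def not_less\<close>)
  have cM: "real (card M) \<le> ?n * (c * (real (Suc j) * (2 ^ ?k * c / \<epsilon> * (N / ?n))))" unfolding M_def
  proof (intro card_UN_le_real)
    fix v T y
    show "real (card {T'\<in>H y. \<not> T' \<subseteq> T}) \<le> 2 ^ ?k * c / \<epsilon>"
      using card_mono[OF fH[of y], of "{T'\<in>H y. \<not> T' \<subseteq> T}"] cH[of y] by (auto intro: order_trans[rotated])
    fix T' assume T: "T \<in> S v" and T': "T' \<in> {T'\<in>H y. \<not> T' \<subseteq> T}"
    have "finite T'" using T' finV finite_subset by (auto simp: H_def)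
    then have "card T < card (T \<union> T')" using T' fT[OF T] by (intro psubset_card_mono) auto
    then have "j + 2 \<le> card (T \<union> T')" using S(3)[OF T] by simp
    then show "real (card (sup (T \<union> T'))) \<le> N / ?n" using sup_le powN(2) by metis
  qed (use finV S fT fH cS c0 eps N0 n1 in auto)
  have cP: "real (card P) \<le> ?n * (c * (?n * (c * (N / (?n * ?n)))))" unfolding P_def
  proof (intro card_UN_le_real)
    fix v T z
    show "real (card {T'\<in>S z. T \<inter> T' = {}}) \<le> c"
      using card_mono[OF S(1)[of z], of "{T'\<in>S z. T \<inter> T' = {}}"] cS[of z] by (auto intro: order_trans[rotated])
    fix T' assume T: "T \<in> S v" and T': "T' \<in> {T'\<in>S z. T \<inter> T' = {}}"
    then have "card (T \<union> T') = card T + card T'" using fT by (intro card_Un_disjoint) auto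
    then have "j + 3 \<le> card (T \<union> T')" using S(3)[OF T] S(3)[of T' z] T' j1 by auto
    then show "real (card (sup (T \<union> T'))) \<le> N / (?n * ?n)" using sup_le powN(3) by metis
  qed (use finV S fT cS c0 N0 n1 in auto)
  have "scattered \<subseteq> L \<union> M \<union> P"
  proof
    fix A assume A: "A \<in> scattered"
    note AV = sF[OF A]
    have "A \<noteq> {}" using AV p2 by auto
    then obtain v where v: "v \<in> A" by blast
    obtain T where T: "T \<in> S v" "T \<subseteq> A" using S(4)[OF A v] by blast
    show "A \<in> L \<union> M \<union> P"
    proof (cases "heavy T")
      case False
      then have "A \<in> L" using T v A AV unfolding L_def sup_def by blast
      then show ?thesis by simp
    next
      case True
      have "card T < card A" using S(3)[OF T(1)] AV p2 by simp
      then have "A \<noteq> T" by auto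
      \<comment> \<open>Covering from a point outside \<open>T\<close> ensures that the second set
        \<open>T'\<close> is not contained in \<open>T\<close>.\<close>
      then obtain z where z: "z \<in> A" "z \<notin> T" using T by blast
      obtain T' where T': "T' \<in> S z" "T' \<subseteq> A" using S(4)[OF A z(1)] by blast
      show ?thesis
      proof (cases "heavy T'")
        case False
        then have "A \<in> L" using T' z A AV unfolding L_def sup_def by blast
        then show ?thesis by simp
      next
        case hT': True
        show ?thesis
        proof (cases "T \<inter> T' = {}")
          case True
          have vz: "v \<in> V" "z \<in> V" using v z AV by auto
          have inS: "A \<in> sup (T \<union> T')" using A T T' by (simp add: sup_def)
          have "A \<in> P" unfolding P_def UN_iff
            by (rule bexI[of _ v], rule bexI[of _ T], rule bexI[of _ z], rule bexI[of _ T'])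
              (simp_all add: vz inS T T' True)
          then show ?thesis by simp
        next
          case False
          then obtain y where y: "y \<in> T" "y \<in> T'" by blast
          have "T' \<in> {T'\<in>H y. \<not> T' \<subseteq> T}" using T' y hT' S(3)[OF T'(1)] z AV by (auto simp: H_def)
          moreover have "A \<in> sup (T \<union> T')" using A T T' by (simp add: sup_def)
          moreover have "v \<in> V" using v AV by auto
          ultimately have "A \<in> M" using T(1) y(1) unfolding M_def by blast
          then show ?thesis by simp
        qed
      qed
    qed
  qed
  then have "card scattered \<le> card (L \<union> M \<union> P)"
    using finV S(1) fsup fT fH unfolding L_def M_def P_def by (intro card_mono) auto
  also have "\<dots> \<le> card L + card M + card P"
    by (meson add_le_mono1 card_Un_le order_trans)
  finally have "real (card scattered) \<le> card L + card M + card P" by simp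
  also have "\<dots> \<le> ?n * (c * (\<epsilon> * N)) + ?n * (c * (real (Suc j) * (2 ^ ?k * c / \<epsilon> * (N / ?n)))) +
      ?n * (c * (?n * (c * (N / (?n * ?n)))))" using cL cM cP by linarith
  also have "\<dots> = c * \<epsilon> * (?n * N) + (c * (real (Suc j) * (2 ^ ?k * c / \<epsilon>)) + c\<^sup>2) * N"
  proof -
    have "n * (c * (\<epsilon> * N)) + n * (c * (a * (h * (N / n)))) + n * (c * (n * (c * (N / (n * n))))) =
        c * \<epsilon> * (n * N) + (c * (a * h) + c\<^sup>2) * N" if "n \<noteq> 0" for n a h :: real
      using that by (simp add: field_simps power2_eq_square)
    note alg = this
    have "?n \<noteq> 0" using n1 by linarith
    then show ?thesis by (rule alg)
  qed
  also have "?n * N = ?n ^ p" unfolding N_def using p2 by (simp add: power_eq_if)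
  finally show ?thesis by (simp add: N_def)
qed

end

section \<open>The exact bound\<close>

text \<open>\<open>3 \<le> j\<close> enters \<open>good_split\<close> twice: a good set has a second
  point, and intersecting cliques share a triple.\<close>

locale clique_family = gap_family V "cliques E V (p + j)" p j
  for V :: "'a set" and E :: "'a \<Rightarrow> 'a \<Rightarrow> bool" and p j :: nat +
  assumes sym: "E u v \<Longrightarrow> E v u" and j3: "3 \<le> j"
begin

lemma clique_family_subset:
  assumes "W \<subseteq> V"
  shows "clique_family W E p j"
proof
  have sub: "cliques E W (p + j) \<subseteq> cliques E V (p + j)" using assms by (auto simp: cliques_def)
  show "finite W" using assms finV finite_subset by blast
  show "A \<subseteq> W \<and> card A = p + j" if "A \<in> cliques E W (p + j)" for A using that by (auto simp: cliques_def)
  show "j \<le> card (A \<inter> B)"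
    if "A \<in> cliques E W (p + j)" "B \<in> cliques E W (p + j)" "A \<inter> B \<noteq> {}" for A B
    using that sub by (intro meet) auto
qed (use p2 j1 sym j3 in auto)

text \<open>Let \<open>W\<close> be the union of the cliques disjoint from \<open>D\<close>. As
  \<open>D\<close> is good, every clique contains \<open>D\<close> or lies in \<open>W\<close>. The
  cliques through \<open>D\<close> that avoid \<open>W\<close> are bounded by Zykov's theorem, and
  those that meet \<open>W\<close> are of lower order.\<close>

lemma good_split:
  assumes D: "good D" and A0: "A0 \<in> cliques E V (p + j)" "D \<subseteq> A0"
  shows "\<exists>W\<subseteq>V. card W + j \<le> card V \<and>
    real (card {A\<in>cliques E V (p + j). D \<subseteq> A}) \<le> tau p (card V - j - card W) + 2 ^ (p + j) * real (card V) ^ (p - 2) \<and>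
    card (cliques E V (p + j)) \<le> card {A\<in>cliques E V (p + j). D \<subseteq> A} + card (cliques E W (p + j)) \<and>
    (W = {} \<longrightarrow> card (cliques E V (p + j)) \<le> tau p (card V - j))"
proof -
  let ?F = "cliques E V (p + j)"
  let ?n = "real (card V)"
  let ?k = "p + j"
  define W where "W = \<Union>{A\<in>?F. A \<inter> D = {}}"
  have fF: "finite ?F" using finV by (rule finite_cliques)
  have A0V: "A0 \<subseteq> V" "clq E A0" using A0 by (auto simp: cliques_def)
  have DV: "D \<subseteq> V" using A0 A0V by blast
  have fD: "finite D" using DV finV finite_subset by blast
  have cD: "card D = j" and gD: "\<And>B. B \<in> ?F \<Longrightarrow> B \<inter> D \<noteq> {} \<Longrightarrow> D \<subseteq> B" using D by (auto simp: good_def)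
  have WV: "W \<subseteq> V" unfolding W_def by (auto simp: cliques_def)
  have fW: "finite W" using WV finV finite_subset by blast
  have WD: "W \<inter> D = {}" unfolding W_def by auto
  have "card W + card D = card (W \<union> D)" using fW fD WD by (simp add: card_Un_disjoint)
  also have "\<dots> \<le> card V" using WV DV finV by (intro card_mono) auto
  finally have size: "card W + j \<le> card V" using cD by simp
  have Vne: "V \<noteq> {}" using size j1 by auto
  then have n1: "1 \<le> ?n" using size j1 by simp
  define P where "P = {A\<in>?F. D \<subseteq> A \<and> A \<inter> W = {}}"
  define Q where "Q = {A\<in>?F. D \<subseteq> A \<and> A \<inter> W \<noteq> {}}"
  have FD: "{A\<in>?F. D \<subseteq> A} = P \<union> Q" by (auto simp: P_def Q_def)
  have cP: "card P \<le> tau p (card V - j - card W)"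
  proof -
    define X where "X = {x\<in>V - D - W. \<forall>d\<in>D. E d x}"
    have fX: "finite X" using finV by (simp add: X_def)
    \<comment> \<open>A \<open>(p + 1)\<close>-clique in the common neighbourhood, together with
      \<open>D\<close> minus one point, would be a clique that meets \<open>D\<close> without
      containing it.\<close>
    have free: "cliques E X (p + 1) = {}"
    proof (rule ccontr)
      assume "\<not> ?thesis"
      then obtain Y where Y: "Y \<subseteq> X" "card Y = p + 1" "clq E Y" by (auto simp: cliques_def)
      have fY: "finite Y" using Y fX finite_subset by blast
      have "\<not> D \<subseteq> {}" using cD j1 by auto
      then obtain d where d: "d \<in> D" by blast
      have "\<not> D \<subseteq> {d}" using cD j3 card_mono[of "{d}" D] by auto
      then obtain d' where d': "d' \<in> D" "d' \<noteq> d" by blast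
      let ?A = "(D \<union> Y) - {d}"
      have cl: "clq E (D \<union> Y)"
        using A0V(2) A0(2) Y sym unfolding clq_def X_def by blast
      have "card (D \<union> Y) = j + (p + 1)" using Y fY fD cD by (subst card_Un_disjoint) (auto simp: X_def)
      then have "card ?A = p + j" using d fD fY by simp
      moreover have "D \<union> Y \<subseteq> V" using DV Y by (auto simp: X_def)
      ultimately have "?A \<in> ?F" using clq_subset[OF cl, of ?A] by (auto simp: cliques_def)
      moreover have "?A \<inter> D \<noteq> {}" using d' by blast
      ultimately show False using gD d by blast
    qed
    have "inj_on (\<lambda>A. A - D) P" by (rule inj_onI) (auto simp: P_def)
    then have "card P = card ((\<lambda>A. A - D) ` P)" by (simp add: card_image)
    also have "\<dots> \<le> card (cliques E X p)"
    proof (intro card_mono finite_cliques fX image_subsetI)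
      fix A assume A: "A \<in> P"
      then have A': "A \<subseteq> V" "card A = p + j" "clq E A" "D \<subseteq> A" "A \<inter> W = {}" by (auto simp: P_def cliques_def)
      have "card (A - D) = p" using A' fD cD by (simp add: card_Diff_subset)
      moreover have "A - D \<subseteq> X"
      proof
        fix x assume x: "x \<in> A - D"
        have "E d x" if "d \<in> D" for d
          using A'(3,4) x that unfolding clq_def by (metis DiffD1 DiffD2 subsetD)
        then show "x \<in> X" using A' x by (auto simp: X_def)
      qed
      ultimately show "A - D \<in> cliques E X p" using clq_subset[OF A'(3), of "A - D"] by (auto simp: cliques_def)
    qed
    also have "\<dots> \<le> tau p (card X)" using p2 by (intro card_cliques_le_tau[OF fX sym free]) auto
    also have "\<dots> \<le> tau p (card V - j - card W)"
    proof (rule tau_mono)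
      have "card X \<le> card (V - (D \<union> W))" using finV by (intro card_mono) (auto simp: X_def)
      also have "\<dots> = card V - card (D \<union> W)" using DV WV fD fW by (intro card_Diff_subset) auto
      also have "card (D \<union> W) = j + card W" using fD fW WD cD by (subst card_Un_disjoint) auto
      finally show "card X \<le> card V - j - card W" by simp
    qed (use p2 in simp)
    finally show ?thesis .
  qed
  \<comment> \<open>Such a clique shares at least three points with some \<open>B x\<close> disjoint
    from \<open>D\<close>. Hence it contains one of at most \<open>2 ^ ?k * ?n\<close> sets of
    \<open>j + 3\<close> points.\<close>
  have cQ: "real (card Q) \<le> 2 ^ ?k * ?n ^ (p - 2)"
  proof -
    have "\<exists>B\<in>?F. B \<inter> D = {} \<and> x \<in> B" if "x \<in> W" for x using that by (auto simp: W_def)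
    then obtain B where B: "\<And>x. x \<in> W \<Longrightarrow> B x \<in> ?F" "\<And>x. x \<in> W \<Longrightarrow> B x \<inter> D = {}"
      "\<And>x. x \<in> W \<Longrightarrow> x \<in> B x" by metis
    define S where "S x = {S. S \<subseteq> B x \<and> card S = 3}" for x
    have fB: "finite (B x)" "card (B x) = ?k" if "x \<in> W" for x using finite_member F B(1)[OF that] by auto
    have fS: "finite (S x)" if "x \<in> W" for x using fB[OF that] by (simp add: S_def)
    define QQ where "QQ = (\<Union>x\<in>W. \<Union>T\<in>S x. {A\<in>?F. D \<union> T \<subseteq> A})"
    have "Q \<subseteq> QQ"
    proof
      fix A assume A: "A \<in> Q"
      then obtain x where x: "x \<in> A" "x \<in> W" by (auto simp: Q_def)
      have AF: "A \<in> ?F" using A by (simp add: Q_def)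
      have "A \<inter> B x \<noteq> {}" using x B(3) by blast
      then have "3 \<le> card (A \<inter> B x)" using meet[OF AF B(1)[OF x(2)]] j3 by simp
      then obtain T where "T \<subseteq> A \<inter> B x" "card T = 3" by (metis obtain_subset_with_card_n)
      then show "A \<in> QQ" using A x unfolding QQ_def S_def Q_def by blast
    qed
    then have "card Q \<le> card QQ" using fW fS fF by (intro card_mono) (auto simp: QQ_def)
    moreover have "real (card QQ) \<le> ?n * (2 ^ ?k * (?n ^ ?k / ?n ^ (j + 3)))" unfolding QQ_def
    proof (intro card_UN_le_real)
      show "real (card W) \<le> ?n" using card_mono[OF finV WV] by simp
      fix x assume x: "x \<in> W"
      have "card (S x) \<le> card (Pow (B x))" using fB[OF x] by (intro card_mono) (auto simp: S_def)
      then have "card (S x) \<le> 2 ^ ?k" using fB[OF x] by (simp add: card_Pow)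
      then show "real (card (S x)) \<le> 2 ^ ?k" by simp
      fix T assume "T \<in> S x"
      then have T: "T \<subseteq> B x" "card T = 3" by (auto simp: S_def)
      then have "finite T" using fB[OF x] finite_subset by blast
      then have "card (D \<union> T) = j + 3" using T B(2)[OF x] fD cD by (subst card_Un_disjoint) auto
      then show "real (card {A\<in>?F. D \<union> T \<subseteq> A}) \<le> ?n ^ ?k / ?n ^ (j + 3)"
        using card_supersets_le[OF finV Vne F, where m = "j + 3" and T = "D \<union> T"] by simp
    qed (use fW fS n1 in auto)
    moreover have "?n * (2 ^ ?k * (?n ^ ?k / ?n ^ (j + 3))) = 2 ^ ?k * ?n ^ (p - 2)"
    proof -
      have "?n ^ ?k = ?n ^ (p - 2) * ?n ^ (j + 2)" using p2
        by (subst power_add[symmetric]) (intro arg_cong[of _ _ "power _"], simp)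
      then show ?thesis using n1 by (simp add: field_simps numeral_eq_Suc)
    qed
    ultimately show ?thesis by linarith
  qed
  have "card {A\<in>?F. D \<subseteq> A} \<le> card P + card Q" unfolding FD by (rule card_Un_le)
  then have 1: "real (card {A\<in>?F. D \<subseteq> A}) \<le> tau p (card V - j - card W) + 2 ^ ?k * ?n ^ (p - 2)"
    using cP cQ by linarith
  have sub: "?F \<subseteq> {A\<in>?F. D \<subseteq> A} \<union> cliques E W ?k"
  proof
    fix A assume A: "A \<in> ?F"
    show "A \<in> {A\<in>?F. D \<subseteq> A} \<union> cliques E W ?k"
    proof (cases "A \<inter> D = {}")
      case True
      then have "A \<subseteq> W" using A by (auto simp: W_def)
      then show ?thesis using A by (auto simp: cliques_def)
    qed (use A gD in blast)
  qed
  then have "card ?F \<le> card ({A\<in>?F. D \<subseteq> A} \<union> cliques E W ?k)"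
    using fF finite_cliques[OF fW] by (intro card_mono) auto
  then have 2: "card ?F \<le> card {A\<in>?F. D \<subseteq> A} + card (cliques E W ?k)"
    using card_Un_le order_trans by blast
  have 3: "card ?F \<le> tau p (card V - j)" if W0: "W = {}"
  proof -
    have "cliques E W ?k = {}" using W0 p2 by (auto simp: cliques_def)
    then have "?F \<subseteq> P" using sub W0 unfolding P_def by auto
    then have "card ?F \<le> card P" using fF by (intro card_mono) (auto simp: P_def)
    then show ?thesis using cP W0 by simp
  qed
  show ?thesis using WV size 1 2 3 by (intro exI[of _ W]) simp
qed

end

section \<open>Inequalities for powers\<close>

lemma power_pred:
  fixes z :: real
  assumes "2 \<le> p"
  shows "z ^ p = z * z ^ (p - 1)" "z ^ (p - 1) = z * z ^ (p - 2)"
proof -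
  define m where "m = p - 2"
  have "p = Suc (Suc m)" using assms by (simp add: m_def)
  then show "z ^ p = z * z ^ (p - 1)" "z ^ (p - 1) = z * z ^ (p - 2)" by simp_all
qed

text \<open>Superadditivity of the power with an explicit gain, the cross term of the square in
  \<open>z ^ p = z ^ (p - 2) * z\<^sup>2\<close>. The gain is what excludes a \<open>W\<close> of
  intermediate size in \<open>clique_family_bound\<close>.\<close>

lemma add_power_le:
  fixes x y :: real
  assumes "0 \<le> x" "0 \<le> y" "2 \<le> p"
  shows "x ^ p + y ^ p + 2 * x * y * (x + y) ^ (p - 2) \<le> (x + y) ^ p"
proof -
  have split: "z ^ p = z ^ (p - 2) * z\<^sup>2" for z :: real
    using assms(3) by (subst power_add[symmetric]) (intro arg_cong[of _ _ "power _"], simp)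
  have "x ^ (p - 2) * x\<^sup>2 \<le> (x + y) ^ (p - 2) * x\<^sup>2" "y ^ (p - 2) * y\<^sup>2 \<le> (x + y) ^ (p - 2) * y\<^sup>2"
    using assms by (auto intro!: mult_right_mono power_mono)
  then show ?thesis unfolding split[of x] split[of y] split[of "x + y"]
    by (simp add: power2_sum algebra_simps)
qed

text \<open>Bernoulli's inequality at \<open>- d / n\<close>, scaled by
  \<open>n ^ p\<close>.\<close>

lemma power_diff_ge:
  fixes n d :: real
  assumes "0 < n" "d \<le> n" "1 \<le> p"
  shows "n ^ p - p * d * n ^ (p - 1) \<le> (n - d) ^ p"
proof -
  have "1 + real p * (- d / n) \<le> (1 + - d / n) ^ p"
    using assms by (intro Bernoulli_inequality) (simp add: field_simps)
  then have "n ^ p * (1 + real p * (- d / n)) \<le> n ^ p * (1 + - d / n) ^ p"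
    using assms by (intro mult_left_mono) auto
  also have "\<dots> = (n - d) ^ p" using assms by (simp add: field_simps flip: power_mult_distrib)
  also have "n ^ p * (1 + real p * (- d / n)) = n ^ p - p * d * n ^ (p - 1)"
    using assms by (simp add: field_simps power_eq_if)
  finally show ?thesis .
qed

lemma tau_ge_real:
  assumes "1 \<le> p" "p \<le> m"
  shows "(real m - p) ^ p \<le> real p ^ p * tau p m"
proof -
  have "m = p * (m div p) + m mod p" "m mod p < p" using assms by simp_all
  then have "real m - p \<le> p * real (m div p)"
    by (metis add_left_mono diff_le_eq less_imp_le of_nat_add of_nat_le_iff of_nat_mult add.commute)
  then have "(real m - p) ^ p \<le> (p * real (m div p)) ^ p" using assms by (intro power_mono) auto
  also have "\<dots> = real p ^ p * real ((m div p) ^ p)" by (simp add: power_mult_distrib)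
  also have "\<dots> \<le> real p ^ p * tau p m"
    using tau_ge[of m p] by (intro mult_left_mono) (simp_all only: of_nat_le_iff, simp)
  finally show ?thesis .
qed

text \<open>Induction on the number of vertices. Without a good set in a clique all cliques are
  scattered. Otherwise \<open>good_split\<close> leaves the cliques in the smaller set
  \<open>W\<close>, and the leading terms add up by superadditivity of the power.\<close>

lemma clique_family_weak_bound:
  assumes "2 \<le> p" "3 \<le> j"
  shows "\<exists>K\<ge>0. \<forall>(V :: 'a set) E. clique_family V E p j \<longrightarrow>
    real (card (cliques E V (p + j))) \<le> (card V / real p) ^ p + K * real (card V) ^ (p - 1)"
proof -
  define c where "c = real (2 ^ (p + j) * (p + j))"
  have c: "c > 0" using assms by (simp add: c_def)
  \<comment> \<open>Chosen so that \<open>c * \<epsilon>\<close> is \<open>1 / p ^ p\<close>, the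
    leading coefficient claimed.\<close>
  define \<epsilon> where "\<epsilon> = 1 / (c * real p ^ p)"
  have eps: "\<epsilon> > 0" using c assms by (simp add: \<epsilon>_def)
  have ceps: "c * \<epsilon> = (1 / real p) ^ p" using c assms by (simp add: \<epsilon>_def power_one_over)
  define K where "K = (c * (real (Suc j) * (2 ^ (p + j) * c / \<epsilon>)) + c\<^sup>2) + 2 ^ (p + j)"
  have K: "2 ^ (p + j) \<le> K" "c * (real (Suc j) * (2 ^ (p + j) * c / \<epsilon>)) + c\<^sup>2 \<le> K"
    using c eps by (simp_all add: K_def)
  have K0: "0 \<le> K" using K(1) by (rule order_trans[rotated]) simp
  have "real (card (cliques E V (p + j))) \<le> (card V / real p) ^ p + K * real (card V) ^ (p - 1)"
    if "clique_family V E p j" for V :: "'a set" and E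
    using that
  proof (induction "card V" arbitrary: V rule: less_induct)
    case less
    interpret clique_family V E p j by fact
    let ?F = "cliques E V (p + j)"
    let ?n = "real (card V)"
    show ?case
    proof (cases "\<exists>D A. good D \<and> A \<in> ?F \<and> D \<subseteq> A")
      case False
      then have "scattered = ?F" by (auto simp: scattered_def)
      show ?thesis
      proof (cases "V = {}")
        case True
        then have "?F = {}" using p2 by (auto simp: cliques_def)
        then show ?thesis using K0 by simp
      next
        case False
        have "real (card ?F) \<le> c * \<epsilon> * ?n ^ p + (c * (real (Suc j) * (2 ^ (p + j) * c / \<epsilon>)) + c\<^sup>2) * ?n ^ (p - 1)"
          using card_scattered_le[OF eps False] unfolding \<open>scattered = ?F\<close> c_def by simp
        also have "c * \<epsilon> * ?n ^ p = (?n / p) ^ p" unfolding ceps by (simp add: power_divide)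
        also have "(c * (real (Suc j) * (2 ^ (p + j) * c / \<epsilon>)) + c\<^sup>2) * ?n ^ (p - 1) \<le> K * ?n ^ (p - 1)"
          by (intro mult_right_mono K) simp
        finally show ?thesis by simp
      qed
    next
      case True
      then obtain D A where D: "good D" "A \<in> ?F" "D \<subseteq> A" by blast
      obtain W where W: "W \<subseteq> V" "card W + j \<le> card V"
        and F1: "real (card {A\<in>?F. D \<subseteq> A}) \<le> tau p (card V - j - card W) + 2 ^ (p + j) * ?n ^ (p - 2)"
        and F2: "card ?F \<le> card {A\<in>?F. D \<subseteq> A} + card (cliques E W (p + j))"
        using good_split[OF D] by blast
      let ?w = "real (card W)" and ?a = "real (card V - j - card W)"
      have n: "1 \<le> ?n" "?w \<le> ?n - 1" using W(2) assms by linarith+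
      have aw: "?a + ?w \<le> ?n" using W(2) by simp
      have "card W < card V" using W(2) assms by simp
      then have IH: "real (card (cliques E W (p + j))) \<le> (?w / real p) ^ p + K * ?w ^ (p - 1)"
        using less.hyps clique_family_subset[OF W(1)] by blast
      note pw = power_pred(2)[OF assms(1)]
      \<comment> \<open>Since \<open>?w \<le> ?n - 1\<close>, the error term in the induction
        hypothesis leaves \<open>K * ?n ^ (p - 2)\<close> to spare, enough to absorb the new
        error.\<close>
      have "K * ?w ^ (p - 1) + 2 ^ (p + j) * ?n ^ (p - 2) \<le> K * ?n ^ (p - 1)"
      proof -
        have "?w ^ (p - 1) \<le> (?n - 1) * ?n ^ (p - 2)"
          unfolding pw using n by (intro mult_mono power_mono) auto
        then have "K * ?w ^ (p - 1) \<le> K * ((?n - 1) * ?n ^ (p - 2))" using K0 by (rule mult_left_mono)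
        moreover have "2 ^ (p + j) * ?n ^ (p - 2) \<le> K * ?n ^ (p - 2)" by (intro mult_right_mono K) simp
        ultimately show ?thesis unfolding pw[of ?n] by (simp add: algebra_simps)
      qed
      moreover have "real (tau p (card V - j - card W)) \<le> (?a / p) ^ p" using assms by (intro tau_le) simp
      moreover have "(?a / p) ^ p + (?w / p) ^ p \<le> (?n / p) ^ p"
      proof -
        have "(?a / p) ^ p + (?w / p) ^ p + 2 * (?a / p) * (?w / p) * (?a / p + ?w / p) ^ (p - 2) \<le> (?a / p + ?w / p) ^ p"
          using assms by (intro add_power_le) auto
        moreover have "0 \<le> 2 * (?a / p) * (?w / p) * (?a / p + ?w / p) ^ (p - 2)" by simp
        moreover have "(?a / p + ?w / p) ^ p \<le> (?n / p) ^ p"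
          using aw by (intro power_mono) (simp_all add: divide_right_mono flip: add_divide_distrib)
        ultimately show ?thesis by linarith
      qed
      ultimately show ?thesis using F1 F2 IH by linarith
    qed
  qed
  then show ?thesis using K0 by blast
qed

text \<open>With more than \<open>tau p (card V - j)\<close> cliques, the set \<open>W\<close> of
  any good set inside a clique must contain all but boundedly many vertices, so only
  \<open>O(n ^ (p - 2))\<close> cliques pass through that good set. All cliques with a good subset
  then number \<open>O(n ^ (p - 1))\<close>, and the scattered ones are too few to make up the
  rest.\<close>

lemma clique_family_bound:
  assumes "2 \<le> p" "3 \<le> j"
  shows "\<exists>n0. \<forall>(V :: 'a set) E. clique_family V E p j \<longrightarrow> n0 \<le> card V \<longrightarrow>
    card (cliques E V (p + j)) \<le> tau p (card V - j)"
proof -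
  obtain K where K0: "0 \<le> K"
    and weak: "\<And>(V :: 'a set) E. clique_family V E p j \<Longrightarrow>
      real (card (cliques E V (p + j))) \<le> (card V / real p) ^ p + K * real (card V) ^ (p - 1)"
    using clique_family_weak_bound[OF assms] by blast
  define q where "q = real p ^ p"
  have q: "q > 0" using assms by (simp add: q_def)
  define h :: real where "h = 2 ^ (p + j)"
  have h: "h > 0" by (simp add: h_def)
  define c where "c = real (2 ^ (p + j) * (p + j))"
  have c: "c > 0" using assms by (simp add: c_def)
  \<comment> \<open>Makes the scattered cliques at most half of the leading term
    \<open>n ^ p / q\<close> of \<open>tau\<close>.\<close>
  define \<epsilon> where "\<epsilon> = 1 / (2 * q * c)"
  have eps: "\<epsilon> > 0" using c q by (simp add: \<epsilon>_def)
  have ceps: "c * \<epsilon> = 1 / (2 * q)" using c q by (simp add: \<epsilon>_def)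
  define C where "C = c * (real (Suc j) * (2 ^ (p + j) * c / \<epsilon>)) + c\<^sup>2"
  have C0: "0 \<le> C" using c eps by (simp add: C_def)
  \<comment> \<open>Sized for the convexity step: \<open>q * K\<close> and
    \<open>q * h * 2 ^ p\<close> absorb the errors of the weak bound and of
    \<open>good_split\<close>, and \<open>p * p\<close> the Bernoulli loss in passing to
    \<open>(?M - p) ^ p\<close>.\<close>
  define w0 where "w0 = 1 + real p * p + q * K + q * h * 2 ^ p"
  have w0: "1 \<le> w0" using q K0 h by (simp add: w0_def)
  define C1 where "C1 = w0 ^ p + K * w0 ^ (p - 1)"
  have C10: "0 \<le> C1" using w0 K0 by (simp add: C1_def)
  define n0 where "n0 = 1 + 2 * (real j + p) + (2 * real p) ^ (p - 1) * (h + C1) +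
    2 * (q * (C + w0 ^ p + h) + real p * (j + p))"
  have n0: "1 + 2 * real j + 2 * real p \<le> n0" "(2 * real p) ^ (p - 1) * (h + C1) \<le> n0"
    "2 * (q * (C + w0 ^ p + h) + real p * (j + p)) < n0"
    using C10 C0 w0 h q assms unfolding n0_def by (simp_all add: add_nonneg_nonneg add_pos_nonneg)
  have "card (cliques E V (p + j)) \<le> tau p (card V - j)"
    if fam: "clique_family V E p j" and big: "n0 \<le> real (card V)" for V :: "'a set" and E
  proof (rule ccontr)
    assume neg: "\<not> ?thesis"
    interpret clique_family V E p j by fact
    let ?F = "cliques E V (p + j)"
    let ?n = "real (card V)"
    let ?N = "card V - j"
    have "1 + 2 * real j + 2 * real p \<le> ?n" using n0(1) big by linarith
    moreover have "3 \<le> real j" "2 \<le> real p" using assms by simp_all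
    ultimately have nj: "1 + 2 * real j + 2 * real p \<le> ?n" "3 \<le> real j" "2 \<le> real p" .
    then have N: "real ?N = ?n - j" by (simp add: of_nat_diff)
    have n1: "1 \<le> ?n" by (rule order_trans[OF _ nj(1)]) simp
    have "real (j + p + 1) \<le> ?n" by (rule order_trans[OF _ nj(1)]) simp
    then have nat_n: "j + p + 1 \<le> card V" by (simp only: of_nat_le_iff)
    have lower: "(?n - j - p) ^ p \<le> q * tau p ?N"
      using tau_ge_real[of p ?N] nj assms N unfolding q_def by (simp add: algebra_simps)
    note pw2 = power_pred(1)[OF assms(1)] and pw1 = power_pred(2)[OF assms(1)]
    have divp: "z / real p \<le> z" if "0 \<le> z" for z :: real
    proof -
      have "z * 1 \<le> z * real p" using that assms by (intro mult_left_mono) auto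
      then show ?thesis using assms by (simp add: divide_le_eq)
    qed
    have split: "\<exists>W\<subseteq>V. card W + j \<le> card V \<and> w0 \<le> real (card W) \<and> real (?N - card W) < w0 \<and>
        real (card {A\<in>?F. D \<subseteq> A}) \<le> tau p (?N - card W) + h * ?n ^ (p - 2)"
      if D: "good D" "A \<in> ?F" "D \<subseteq> A" for D A
    proof -
      obtain W where W: "W \<subseteq> V" "card W + j \<le> card V"
        and F1: "real (card {A\<in>?F. D \<subseteq> A}) \<le> tau p (?N - card W) + h * ?n ^ (p - 2)"
        and F2: "card ?F \<le> card {A\<in>?F. D \<subseteq> A} + card (cliques E W (p + j))"
        and F3: "W = {} \<longrightarrow> card ?F \<le> tau p ?N"
        using good_split[OF D] unfolding h_def by blast
      let ?w = "real (card W)" and ?a = "real (?N - card W)"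
      have aw: "?a + ?w = real ?N" using W(2) by simp
      have Fw: "real (card (cliques E W (p + j))) \<le> (?w / p) ^ p + K * ?w ^ (p - 1)"
        by (rule weak[OF clique_family_subset[OF W(1)]])
      have total: "real (tau p ?N) < tau p (?N - card W) + h * ?n ^ (p - 2) + ((?w / p) ^ p + K * ?w ^ (p - 1))"
        using neg F1 F2 Fw by linarith
      have "W \<noteq> {}" using F3 neg by blast
      then have "0 < card W" using finite_subset[OF W(1) finV] by (simp add: card_gt_0_iff)
      then have w1: "1 \<le> card W" by simp
      \<comment> \<open>A nonempty \<open>W\<close> below \<open>w0\<close> carries at most
        \<open>C1\<close> cliques, while losing even one vertex lowers \<open>tau\<close> by order
        \<open>n ^ (p - 1)\<close>.\<close>
      have large: "w0 \<le> ?w"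
      proof (rule ccontr)
        assume "\<not> ?thesis"
        then have w: "?w \<le> w0" by simp
        have "(?w / p) ^ p \<le> w0 ^ p"
          using w divp[of ?w] by (intro power_mono) simp_all
        moreover have "K * ?w ^ (p - 1) \<le> K * w0 ^ (p - 1)" using w K0 by (intro mult_left_mono power_mono) auto
        moreover have "tau p (?N - card W) \<le> tau p (?N - 1)" using w1 assms by (intro tau_mono) auto
        ultimately have up: "real (tau p ?N) < tau p (?N - 1) + h * ?n ^ (p - 2) + C1"
          using total unfolding C1_def by linarith
        have "tau p (?N - 1) + ((?N - 1) div p) ^ (p - 1) \<le> tau p ?N"
        proof -
          have "Suc (?N - 1) = ?N" using nat_n by simp
          then show ?thesis using tau_Suc[of p "?N - 1"] assms by simp
        qed
        then have "real (((?N - 1) div p) ^ (p - 1)) < h * ?n ^ (p - 2) + C1" using up by linarith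
        moreover have "?n / (2 * p) \<le> real ((?N - 1) div p)"
        proof -
          have "?N - 1 = p * ((?N - 1) div p) + (?N - 1) mod p" "(?N - 1) mod p < p" using assms by simp_all
          then have "?N - 1 < p * ((?N - 1) div p) + p" by linarith
          then have "real ?N \<le> p * real ((?N - 1) div p) + p"
            by (metis Suc_leI Suc_pred' less_eq_Suc_le of_nat_add of_nat_le_iff of_nat_mult not_gr_zero le0)
          moreover have "n / 2 \<le> y" if "M \<le> y + p" "M = n - j" "1 + 2 * real j + 2 * real p \<le> n"
            for n M y :: real using that by linarith
          ultimately have "?n / 2 \<le> p * real ((?N - 1) div p)" using N nj(1) by blast
          then show ?thesis using assms by (simp add: field_simps)
        qed
        then have "(?n / (2 * p)) ^ (p - 1) \<le> real ((?N - 1) div p) ^ (p - 1)" by (intro power_mono) auto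
        ultimately have "(?n / (2 * p)) ^ (p - 1) < h * ?n ^ (p - 2) + C1" by simp
        also have "\<dots> \<le> (h + C1) * ?n ^ (p - 2)"
        proof -
          have "1 \<le> ?n ^ (p - 2)" using n1 by simp
          then have "C1 * 1 \<le> C1 * ?n ^ (p - 2)" using C10 by (intro mult_left_mono)
          then show ?thesis by (simp add: algebra_simps)
        qed
        finally have "?n ^ (p - 1) < (2 * real p) ^ (p - 1) * (h + C1) * ?n ^ (p - 2)"
          using assms by (simp add: power_divide field_simps)
        then have "?n < (2 * real p) ^ (p - 1) * (h + C1)"
          unfolding pw1[of ?n] using n1 by (simp only: mult_less_cancel_right) auto
        then show False using n0(2) big by linarith
      qed
      \<comment> \<open>If both \<open>W\<close> and the rest had at least \<open>w0\<close>
        vertices, splitting would cost \<open>w0 * ?M ^ (p - 1)\<close> by convexity, more than all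
        error terms together.\<close>
      moreover have "?a < w0"
      proof (rule ccontr)
        assume "\<not> ?thesis"
        then have a: "w0 \<le> ?a" by simp
        let ?M = "real ?N"
        have M1: "1 \<le> ?M" using N nj by linarith
        have "real (tau p (?N - card W)) \<le> (?a / p) ^ p" using assms by (intro tau_le) simp
        then have "q * real (tau p ?N) < q * ((?a / p) ^ p + h * ?n ^ (p - 2) + ((?w / p) ^ p + K * ?w ^ (p - 1)))"
          using total q by (intro mult_strict_left_mono) linarith+
        also have "\<dots> = ?a ^ p + ?w ^ p + q * h * ?n ^ (p - 2) + q * K * ?w ^ (p - 1)"
          using q assms unfolding q_def by (simp add: power_divide algebra_simps)
        also have "\<dots> \<le> (?M ^ p - w0 * ?M ^ (p - 1)) + q * h * 2 ^ p * ?M ^ (p - 1) + q * K * ?M ^ (p - 1)"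
        proof (intro add_mono)
          have "?a ^ p + ?w ^ p + 2 * ?a * ?w * ?M ^ (p - 2) \<le> ?M ^ p"
            using add_power_le[of ?a ?w p] assms aw by simp
          moreover have "w0 * ?M ^ (p - 1) \<le> 2 * ?a * ?w * ?M ^ (p - 2)"
          proof -
            \<comment> \<open>The larger of the two is at least \<open>?M / 2\<close>, the smaller
              at least \<open>w0\<close>.\<close>
            have "w0 * ?M \<le> 2 * ?a * ?w"
            proof (cases "?a \<le> ?w")
              case True
              then have "w0 * ?M \<le> ?a * (2 * ?w)" using aw a w0 by (intro mult_mono) auto
              then show ?thesis by simp
            next
              case False
              then have "w0 * ?M \<le> ?w * (2 * ?a)" using aw large w0 by (intro mult_mono) auto
              then show ?thesis by (simp add: mult.commute mult.left_commute)
            qed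
            then have "w0 * ?M * ?M ^ (p - 2) \<le> 2 * ?a * ?w * ?M ^ (p - 2)" by (rule mult_right_mono) simp
            then show ?thesis unfolding pw1[of ?M] by (simp add: mult.assoc)
          qed
          ultimately show "?a ^ p + ?w ^ p \<le> ?M ^ p - w0 * ?M ^ (p - 1)" by linarith
          have "?n ^ (p - 2) \<le> (2 * ?M) ^ (p - 2)" using N nj by (intro power_mono) linarith+
          also have "\<dots> = 2 ^ (p - 2) * ?M ^ (p - 2)" by (rule power_mult_distrib)
          also have "\<dots> \<le> 2 ^ p * ?M ^ (p - 1)" using M1 by (intro mult_mono power_increasing) auto
          finally have "q * h * ?n ^ (p - 2) \<le> q * h * (2 ^ p * ?M ^ (p - 1))" using q h by (intro mult_left_mono) auto
          then show "q * h * ?n ^ (p - 2) \<le> q * h * 2 ^ p * ?M ^ (p - 1)" by (simp only: mult.assoc)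
          show "q * K * ?w ^ (p - 1) \<le> q * K * ?M ^ (p - 1)"
            using aw K0 q by (intro mult_left_mono power_mono) auto
        qed
        also have "\<dots> = ?M ^ p - (1 + real p * p) * ?M ^ (p - 1)" unfolding w0_def by (simp add: algebra_simps)
        also have "\<dots> \<le> ?M ^ p - p * real p * ?M ^ (p - 1)" using M1 by (simp add: algebra_simps)
        also have "\<dots> \<le> (?M - p) ^ p" using N nj assms by (intro power_diff_ge) linarith+
        also have "\<dots> \<le> q * tau p ?N" using lower N by simp
        finally show False by simp
      qed
      ultimately show ?thesis using W F1 by blast
    qed
    have small: "real (card {A\<in>?F. D \<subseteq> A}) \<le> (w0 ^ p + h) * ?n ^ (p - 2)"
      if D: "good D" "A \<in> ?F" "D \<subseteq> A" for D A
    proof -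
      obtain W where "W \<subseteq> V" "card W + j \<le> card V" "w0 \<le> real (card W)"
        and a: "real (?N - card W) < w0"
        and F1: "real (card {A\<in>?F. D \<subseteq> A}) \<le> tau p (?N - card W) + h * ?n ^ (p - 2)"
        using split[OF D] by (elim exE conjE) (rule that)
      have "real (tau p (?N - card W)) \<le> (real (?N - card W) / p) ^ p" using assms by (intro tau_le) simp
      also have "\<dots> \<le> w0 ^ p"
        using a divp[of "real (?N - card W)"] by (intro power_mono) simp_all
      also have "\<dots> \<le> w0 ^ p * ?n ^ (p - 2)" using n1 w0 by (simp add: mult_le_cancel_left1)
      finally show ?thesis using F1 by (simp add: algebra_simps)
    qed
    \<comment> \<open>One good set per vertex suffices: a clique with a good subset through
      \<open>v\<close> meets \<open>dd v\<close> in \<open>v\<close> and so contains it. This leaves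
      at most \<open>card V\<close> good sets to sum over.\<close>
    define dd where "dd v = (SOME D. good D \<and> v \<in> D \<and> (\<exists>A\<in>?F. D \<subseteq> A))" for v
    define U where "U = {v\<in>V. \<exists>D. good D \<and> v \<in> D \<and> (\<exists>A\<in>?F. D \<subseteq> A)}"
    have dd: "good (dd v)" "v \<in> dd v" "\<exists>A\<in>?F. dd v \<subseteq> A" if "v \<in> U" for v
      using that someI_ex[of "\<lambda>D. good D \<and> v \<in> D \<and> (\<exists>A\<in>?F. D \<subseteq> A)"] unfolding U_def dd_def by auto
    have fU: "finite U" "card U \<le> card V" using finV by (auto simp: U_def intro: card_mono)
    have "?F \<subseteq> scattered \<union> (\<Union>v\<in>U. {A\<in>?F. dd v \<subseteq> A})"
    proof
      fix A assume A: "A \<in> ?F"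
      show "A \<in> scattered \<union> (\<Union>v\<in>U. {A\<in>?F. dd v \<subseteq> A})"
      proof (cases "A \<in> scattered")
        case False
        then obtain D where D: "good D" "D \<subseteq> A" using A by (auto simp: scattered_def)
        have "D \<noteq> {}" using D(1) assms by (auto simp: good_def)
        then obtain v where v: "v \<in> D" by blast
        have vU: "v \<in> U" using v D A F[OF A] by (auto simp: U_def)
        have "A \<inter> dd v \<noteq> {}" using v D dd(2)[OF vU] by blast
        then have "dd v \<subseteq> A" using dd(1)[OF vU] A by (auto simp: good_def)
        then show ?thesis using vU A by blast
      qed simp
    qed
    then have "card ?F \<le> card (scattered \<union> (\<Union>v\<in>U. {A\<in>?F. dd v \<subseteq> A}))"
      using finite_scattered fU finite_cliques[OF finV, of E] by (intro card_mono) auto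
    also have "\<dots> \<le> card scattered + card (\<Union>v\<in>U. {A\<in>?F. dd v \<subseteq> A})" by (rule card_Un_le)
    finally have "real (card ?F) \<le> card scattered + card (\<Union>v\<in>U. {A\<in>?F. dd v \<subseteq> A})" by simp
    moreover have "real (card (\<Union>v\<in>U. {A\<in>?F. dd v \<subseteq> A})) \<le> ?n * ((w0 ^ p + h) * ?n ^ (p - 2))"
    proof (intro card_UN_le_real)
      show "real (card {A\<in>?F. dd v \<subseteq> A}) \<le> (w0 ^ p + h) * ?n ^ (p - 2)" if "v \<in> U" for v
        using dd[OF that] small by blast
    qed (use fU w0 h in auto)
    moreover have "real (card scattered) \<le> 1 / (2 * q) * ?n ^ p + C * ?n ^ (p - 1)"
    proof -
      have "V \<noteq> {}" using n1 by auto
      then show ?thesis using card_scattered_le[OF eps] ceps unfolding C_def c_def by simp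
    qed
    ultimately have "real (card ?F) \<le> 1 / (2 * q) * ?n ^ p + (C + w0 ^ p + h) * ?n ^ (p - 1)"
      unfolding pw1 by (simp add: algebra_simps)
    then have "q * real (card ?F) \<le> q * (1 / (2 * q) * ?n ^ p + (C + w0 ^ p + h) * ?n ^ (p - 1))"
      using q by (intro mult_left_mono) auto
    also have "\<dots> = ?n ^ p / 2 + q * (C + w0 ^ p + h) * ?n ^ (p - 1)"
      using q by (simp add: algebra_simps)
    finally have "q * real (card ?F) \<le> ?n ^ p / 2 + q * (C + w0 ^ p + h) * ?n ^ (p - 1)" .
    moreover have "q * tau p ?N < q * real (card ?F)" using neg q by simp
    moreover have "?n ^ p - p * (real j + p) * ?n ^ (p - 1) \<le> (?n - (real j + p)) ^ p"
      using nj n1 assms by (intro power_diff_ge) linarith+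
    \<comment> \<open>The scattered cliques use only half of the leading term of
      \<open>q * tau p ?N\<close>; the other half would have to be below order
      \<open>n ^ (p - 1)\<close>, which bounds \<open>n\<close>.\<close>
    ultimately have "?n ^ p / 2 < (q * (C + w0 ^ p + h) + p * (real j + p)) * ?n ^ (p - 1)"
      using lower by (simp add: algebra_simps)
    then have "?n / 2 * ?n ^ (p - 1) < (q * (C + w0 ^ p + h) + p * (real j + p)) * ?n ^ (p - 1)"
      unfolding pw2[of ?n] by simp
    then have "?n / 2 < q * (C + w0 ^ p + h) + p * (real j + p)"
      using n1 by (simp only: mult_less_cancel_right) auto
    then show False using n0(3) big by simp
  qed
  then show ?thesis by (intro exI[of _ "nat \<lceil>n0\<rceil>"]) (simp add: ceiling_le_iff nat_le_iff)
qed

text \<open>The case \<open>s = 1\<close> of \<open>clique_intersection_gap\<close>. Here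
  \<open>t + 3 < r\<close> provides \<open>2 \<le> p\<close> and \<open>1 \<le> t\<close> provides
  \<open>3 \<le> j\<close>.\<close>

lemma clique_family_of_book_free:
  assumes V: "finite V" and sym: "\<And>u v. E u v \<Longrightarrow> E v u" and t: "1 \<le> t" "t + 3 < r"
    and no: "\<And>X Y. X \<in> cliques E V r \<Longrightarrow> Y \<in> cliques E V r \<Longrightarrow> card (X \<inter> Y) \<noteq> 1"
  shows "clique_family V E (r - t - 2) (2 * t + 2)"
proof
  have k: "r - t - 2 + (2 * t + 2) = r + t" using t by simp
  fix A B
  assume A: "A \<in> cliques E V (r - t - 2 + (2 * t + 2))"
  then show "A \<subseteq> V \<and> card A = r - t - 2 + (2 * t + 2)" by (simp add: cliques_def)
  have "finite A" using A V finite_subset by (auto simp: cliques_def)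
  moreover assume "A \<inter> B \<noteq> {}"
  ultimately have "0 < card (A \<inter> B)" by (simp add: card_gt_0_iff)
  moreover assume "B \<in> cliques E V (r - t - 2 + (2 * t + 2))"
  then have "card (A \<inter> B) < 1 \<or> 1 + 2 * t + 1 \<le> card (A \<inter> B)"
    using A t unfolding k by (intro clique_intersection_gap[OF V _ no]) auto
  ultimately show "2 * t + 2 \<le> card (A \<inter> B)" by simp
qed (use V t sym in auto)

section \<open>The three estimates\<close>

lemma ex_num_bigomega:
  assumes "s + t < r" "2 \<le> r"
  shows "(\<lambda>n. real (ex_num n (complete_graph (r + t)) (book_graph r s))) \<in> \<Omega>(\<lambda>n. real n ^ (r - s - t - 1))"
proof -
  define p where "p = r - s - t - 1"
  define j where "j = s + 2 * t + 1"
  have r: "r = p + s + t + 1" using assms by (simp add: p_def)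
  \<comment> \<open>\<open>n - j - p\<close> is at least \<open>n / 2\<close> for
    \<open>n \<ge> 2 * (j + p)\<close>, so each part has at least \<open>n / (2 * p)\<close>
    vertices. For \<open>p = 0\<close> the product \<open>tau\<close> is empty and equals 1.\<close>
  define c where "c = (if p = 0 then 1 else (1 / (2 * real p)) ^ p)"
  have c: "c > 0" by (simp add: c_def)
  have "c * real n ^ p \<le> real (ex_num n (complete_graph (r + t)) (book_graph r s))"
    if n: "2 * (j + p) \<le> n" for n
  proof -
    have "c * real n ^ p \<le> tau p (n - j)"
    proof (cases "p = 0")
      case True
      then show ?thesis by (simp add: c_def tau_def)
    next
      case False
      have "real n / 2 \<le> real (n - j) - p" using n by (simp add: of_nat_diff)
      then have "(real n / 2) ^ p \<le> (real (n - j) - p) ^ p" by (intro power_mono) simp_all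
      also have "\<dots> \<le> real p ^ p * tau p (n - j)" using n False by (intro tau_ge_real) auto
      finally show ?thesis using False by (simp add: c_def field_simps power_mult_distrib power_divide)
    qed
    also have "\<dots> \<le> ex_num n (complete_graph (r + t)) (book_graph r s)"
      unfolding of_nat_le_iff by (rule ex_num_ge[OF j_def r assms(2)]) (use n in simp)
    finally show ?thesis by simp
  qed
  then have "eventually (\<lambda>n. norm (real (ex_num n (complete_graph (r + t)) (book_graph r s)))
      \<ge> c * norm (real n ^ p)) sequentially"
    by (intro eventually_sequentiallyI[of "2 * (j + p)"]) simp
  then show ?thesis unfolding p_def[symmetric] by (rule landau_omega.bigI[OF c])
qed

lemma ex_num_bigo:
  assumes "1 \<le> s" "2 * s + t + 1 < r"
  shows "(\<lambda>n. real (ex_num n (complete_graph (r + t)) (book_graph r s))) \<in> O(\<lambda>n. real n ^ (r - s - t - 1))"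
proof -
  define p where "p = r - s - t - 1"
  define k where "k = r + t"
  define C where "C = k ^ k * (2 * (2 ^ k + 1) * (k + 1)) ^ 2 ^ k"
  \<comment> \<open>The gap has length \<open>2 * t + 1\<close>, and
    \<open>2 * s + t + 1 < r\<close> yields the condition \<open>s \<le> p\<close> of the
    Frankl--Katona step.\<close>
  have k: "k = p + s + (2 * t + 1)" and sp: "s \<le> p" using assms by (simp_all add: k_def p_def)
  have "ex_num n (complete_graph k) (book_graph r s) \<le> C * n ^ p" for n
  proof (rule ex_num_le)
    fix G :: "nat graph"
    assume G: "finite (verts G)" "card (verts G) = n"
      and no: "\<And>X Y. X \<in> cliques (adj G) (verts G) r \<Longrightarrow> Y \<in> cliques (adj G) (verts G) r \<Longrightarrow> card (X \<inter> Y) \<noteq> s"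
    have "card (cliques (adj G) (verts G) k) \<le> C * card (verts G) ^ p"
      unfolding C_def
    proof (rule card_family_gap_le[OF G(1) k _ sp])
      fix A B assume AB: "A \<in> cliques (adj G) (verts G) k" "B \<in> cliques (adj G) (verts G) k"
      have "card (A \<inter> B) < s \<or> s + 2 * t + 1 \<le> card (A \<inter> B)"
        using AB assms unfolding k_def by (intro clique_intersection_gap[OF G(1) _ no]) auto
      then show "card (A \<inter> B) < s \<or> s + (2 * t + 1) \<le> card (A \<inter> B)" by simp
    qed (auto simp: cliques_def)
    then show "card (cliques (adj G) (verts G) k) \<le> C * n ^ p" using G by simp
  qed (use assms in auto)
  then have "norm (real (ex_num n (complete_graph (r + t)) (book_graph r s))) \<le> real C * norm (real n ^ p)" for n
    unfolding k_def by (metis norm_of_nat of_nat_le_iff of_nat_mult of_nat_power)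
  then show ?thesis unfolding p_def[symmetric] by (intro bigoI[of _ "real C"]) simp
qed

lemma ex_num_eq_tau:
  assumes t: "1 \<le> t" "t + 3 < r"
  shows "\<forall>\<^sub>F n in sequentially. ex_num n (complete_graph (r + t)) (book_graph r 1) = tau (r - t - 2) (n - (2 * t + 2))"
proof -
  define p where "p = r - t - 2"
  define j where "j = 2 * t + 2"
  have k: "r + t = p + j" and p: "2 \<le> p" and j: "3 \<le> j" using t by (simp_all add: p_def j_def)
  obtain n0 where n0: "\<And>(V :: nat set) E. clique_family V E p j \<Longrightarrow> n0 \<le> card V \<Longrightarrow>
      card (cliques E V (p + j)) \<le> tau p (card V - j)"
    using clique_family_bound[OF p j] by blast
  have "ex_num n (complete_graph (r + t)) (book_graph r 1) = tau p (n - j)" if n: "max n0 j \<le> n" for n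
  proof (rule antisym)
    show "ex_num n (complete_graph (r + t)) (book_graph r 1) \<le> tau p (n - j)"
    proof (rule ex_num_le)
      fix G :: "nat graph"
      assume G: "finite (verts G)" "card (verts G) = n"
        and no: "\<And>X Y. X \<in> cliques (adj G) (verts G) r \<Longrightarrow> Y \<in> cliques (adj G) (verts G) r \<Longrightarrow> card (X \<inter> Y) \<noteq> 1"
      have "adj G v u" if "adj G u v" for u v using that by (simp add: insert_commute)
      then have "clique_family (verts G) (adj G) p j"
        unfolding p_def j_def by (rule clique_family_of_book_free[OF G(1) _ t no])
      then show "card (cliques (adj G) (verts G) (r + t)) \<le> tau p (n - j)"
        using n0 G n unfolding k by auto
    qed (use t in auto)
    show "tau p (n - j) \<le> ex_num n (complete_graph (r + t)) (book_graph r 1)"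
      by (rule ex_num_ge) (use t n in \<open>auto simp: p_def j_def\<close>)
  qed
  then show ?thesis unfolding p_def[symmetric] j_def[symmetric] by (rule eventually_sequentiallyI)
qed

theorem theorem1p2:
  shows "(\<forall>r s t :: nat. 3 \<le> r \<and> 1 \<le> s \<and> s \<le> r - 1 \<and> 1 \<le> t \<and> t < r - s \<longrightarrow>
            (\<lambda>n. real (ex_num n (complete_graph (r + t)) (book_graph r s)))
              \<in> \<Omega>(\<lambda>n. real n ^ (r - s - t - 1)))
       \<and> (\<forall>r s t :: nat. 3 \<le> r \<and> 1 \<le> s \<and> 1 \<le> t \<and> 2 * s + t + 1 < r \<longrightarrow>
            (\<lambda>n. real (ex_num n (complete_graph (r + t)) (book_graph r s)))
              \<in> \<Theta>(\<lambda>n. real n ^ (r - s - t - 1)))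
       \<and> (\<forall>r t :: nat. 1 \<le> t \<and> t + 3 < r \<longrightarrow>
            (\<forall>\<^sub>F n in sequentially.
               ex_num n (complete_graph (r + t)) (book_graph r 1) =
               num_copies (complete_graph (r + t))
                 (graph_join (complete_graph (2 * t + 2))
                             (turan_graph (n - 2 * t - 2) (r - t - 2)))))"
proof (intro conjI allI impI)
  fix r s t :: nat
  assume "3 \<le> r \<and> 1 \<le> s \<and> s \<le> r - 1 \<and> 1 \<le> t \<and> t < r - s"
  then show "(\<lambda>n. real (ex_num n (complete_graph (r + t)) (book_graph r s)))
      \<in> \<Omega>(\<lambda>n. real n ^ (r - s - t - 1))"
    by (intro ex_num_bigomega) auto
next
  fix r s t :: nat
  assume "3 \<le> r \<and> 1 \<le> s \<and> 1 \<le> t \<and> 2 * s + t + 1 < r"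
  then show "(\<lambda>n. real (ex_num n (complete_graph (r + t)) (book_graph r s)))
      \<in> \<Theta>(\<lambda>n. real n ^ (r - s - t - 1))"
    by (intro bigthetaI ex_num_bigomega ex_num_bigo) auto
next
  fix r t :: nat
  assume rt: "1 \<le> t \<and> t + 3 < r"
  have "num_copies (complete_graph (r + t))
      (graph_join (complete_graph (2 * t + 2)) (turan_graph (n - 2 * t - 2) (r - t - 2)))
    = tau (r - t - 2) (n - (2 * t + 2))" for n
  proof -
    have k: "r + t = (2 * t + 2) + (r - t - 2)" and m: "n - 2 * t - 2 = n - (2 * t + 2)" using rt by auto
    show ?thesis unfolding m by (subst k, rule num_copies_join_turan) (use rt in auto)
  qed
  then show "\<forall>\<^sub>F n in sequentially.
      ex_num n (complete_graph (r + t)) (book_graph r 1) =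
      num_copies (complete_graph (r + t))
        (graph_join (complete_graph (2 * t + 2)) (turan_graph (n - 2 * t - 2) (r - t - 2)))"
    using ex_num_eq_tau[of t r] rt by simp
qed

end
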